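(* The following assertions hold. (i) A topological NDS $(X_\infty,f_\infty)$ has a fine-scale IMS if and only if the sequence $X_\infty$ is uniformly totally bounded, i.e. for each $\alpha>0$ there is $m\in\mathbb{N}$ such that, for every $n\ge0$, $m$ balls of radius $\alpha$ are sufficient to cover $X_n$. (ii) Let $(X_\infty,f_\infty)$ and $(Y_\infty,g_\infty)$ be topological NDS that are equi-conjugate via $\pi_\infty=(\pi_n)_{n=0}^\infty$. Then, if $\mu_\infty$ is a fine-scale IMS for $(X_\infty,f_\infty)$, the sequence $\nu_\infty=(\nu_n)_{n=0}^\infty$ given by $\nu_n=\pi_n\mu_n$ (push-forward) is a fine-scale IMS for $(Y_\infty,g_\infty)$. (iii) Let $(X_\infty,f_\infty)$ and $(Y_\infty,g_\infty)$ be topological NDS with fine-scale IMS $\mu_\infty$ and $\nu_\infty$, respectively. Then $\mu_\infty\times\nu_\infty:=(\mu_n\times\nu_n)_{n\ge0}$ is a fine-scale IMS for the direct product system $(X_\infty\times Y_\infty,f_\infty\times g_\infty)$, given by the spaces $X_n\times Y_n$ and maps $f_n\times g_n$, and $$h(f_\infty\times g_\infty,\mu_\infty\times\nu_\infty)\le h(f_\infty,\mu_\infty)+h(g_\infty,\nu_\infty),$$ where $X_n\times Y_n$ carries the product metric $d_n^\times((x_1,y_1),(x_2,y_2))=\max\{d_n^X(x_1,x_2),d_n^Y(y_1,y_2)\}$.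
   Context: A topological nonautonomous dynamical system (topological NDS) $(X_\infty,f_\infty)$ consists of a sequence $X_\infty=(X_n)_{n\ge0}$ of nonempty compact metric spaces $(X_n,d_n)$ and an equicontinuous sequence $f_\infty=(f_n)_{n\ge0}$ of maps $f_n:X_n\to X_{n+1}$, i.e. for every $\varepsilon>0$ there is $\delta>0$ such that for all $n\ge0$ and $x,y\in X_n$, $d_n(x,y)<\delta$ implies $d_{n+1}(f_n(x),f_n(y))<\varepsilon$. (Equicontinuity of other sequences of maps between metric spaces is defined in the same way.) Put $f_k^n:=f_{k+n-1}\circ\cdots\circ f_k$ for $n\ge1$, $f_k^0:=\mathrm{id}_{X_k}$, $f_k^{-n}:=(f_k^n)^{-1}$ (applied to sets only). An invariant measure sequence (IMS) is a sequence $\mu_\infty=(\mu_n)_{n\ge0}$ of Borel probability measures $\mu_n$ on $X_n$ with $f_n\mu_n=\mu_{n+1}$ (push-forward) for all $n$. $\mathcal{E}_{\mathrm M}(\mu_\infty)$ is the family of admissible sequences: a sequence $\mathcal{P}_\infty=(\mathcal{P}_n)_{n\ge0}$ of finite Borel partitions $\mathcal{P}_n=\{P_{n,1},\dots,P_{n,k_n}\}$ of $X_n$ is in $\mathcal{E}_{\mathrm M}(\mu_\infty)$ iff $(k_n)$ is bounded and for each $\varepsilon>0$ there are $\delta>0$ and compact (possibly empty) sets $K_{n,i}\subset P_{n,i}$ such that for all $n\ge0$: (a) $\mu_n(P_{n,i}\setminus K_{n,i})\le\varepsilon$ for $i=1,\dots,k_n$; (b) for $1\le i<j\le k_n$, $d_n(x,y)\ge\delta$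 for all $x\in K_{n,i}$, $y\in K_{n,j}$. $h(f_\infty,\mu_\infty;\mathcal{P}_\infty):=\limsup_{n\to\infty}\frac1nH_{\mu_0}\big(\bigvee_{i=0}^{n-1}f_0^{-i}\mathcal{P}_i\big)$ with $H_\mu(\mathcal{P})=-\sum_{P\in\mathcal{P}}\mu(P)\log\mu(P)$, and the metric entropy is $h(f_\infty,\mu_\infty):=\sup_{\mathcal{P}_\infty\in\mathcal{E}_{\mathrm M}(\mu_\infty)}h(f_\infty,\mu_\infty;\mathcal{P}_\infty)\in[0,\infty]$. $\operatorname{diam}\mathcal{P}_\infty:=\sup_{n\ge0}\sup_{P\in\mathcal{P}_n}\operatorname{diam}P$. An IMS $\mu_\infty$ is a fine-scale IMS if there is a sequence $(\mathcal{P}^k_\infty)_{k\ge0}$ in $\mathcal{E}_{\mathrm M}(\mu_\infty)$ with $\operatorname{diam}\mathcal{P}^k_\infty\to0$ as $k\to\infty$. $(X_\infty,f_\infty)$ and $(Y_\infty,g_\infty)$ are equi-conjugate via $\pi_\infty=(\pi_n)_{n\ge0}$ if the $\pi_n:X_n\to Y_n$ are homeomorphisms with $\pi_{n+1}\circ f_n=g_n\circ\pi_n$ for all $n\ge0$ and both $(\pi_n)_{n\ge0}$ and $(\pi_n^{-1})_{n\ge0}$ are equicontinuous. *)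

theory Defs
  imports "HOL-Probability.Probability"
begin

text \<open>
  A sequence of metric spaces is a function of type \<open>nat \<Rightarrow> 'a metric\<close>. The spaces are subsets of
  one common type, each with its own metric; every sequence of sets is covered up to bijection by
  taking a large enough type. Maps between the spaces are total HOL functions of which only the
  values on \<open>mspace\<close> matter.
\<close>

definition equicontinuous_maps ::
  "(nat \<Rightarrow> 'a metric) \<Rightarrow> (nat \<Rightarrow> 'b metric) \<Rightarrow> (nat \<Rightarrow> 'a \<Rightarrow> 'b) \<Rightarrow> bool" where
  "equicontinuous_maps X Y h \<longleftrightarrow>
     (\<forall>n. h n \<in> mspace (X n) \<rightarrow> mspace (Y n)) \<and>
     (\<forall>\<epsilon>>0. \<exists>\<delta>>0. \<forall>n. \<forall>x\<in>mspace (X n). \<forall>y\<in>mspace (X n).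
        mdist (X n) x y < \<delta> \<longrightarrow> mdist (Y n) (h n x) (h n y) < \<epsilon>)"

definition topological_NDS :: "(nat \<Rightarrow> 'a metric) \<Rightarrow> (nat \<Rightarrow> 'a \<Rightarrow> 'a) \<Rightarrow> bool" where
  "topological_NDS X f \<longleftrightarrow>
     (\<forall>n. mspace (X n) \<noteq> {} \<and> compact_space (mtopology_of (X n))) \<and>
     equicontinuous_maps X (\<lambda>n. X (Suc n)) f"

fun nds_iterate :: "(nat \<Rightarrow> 'a \<Rightarrow> 'a) \<Rightarrow> nat \<Rightarrow> nat \<Rightarrow> 'a \<Rightarrow> 'a" where
  "nds_iterate f k 0 = id"
| "nds_iterate f k (Suc n) = f (k + n) \<circ> nds_iterate f k n"

definition metric_borel :: "'a metric \<Rightarrow> 'a measure" where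
  "metric_borel X = sigma (mspace X) {U. openin (mtopology_of X) U}"

definition IMS ::
  "(nat \<Rightarrow> 'a metric) \<Rightarrow> (nat \<Rightarrow> 'a \<Rightarrow> 'a) \<Rightarrow> (nat \<Rightarrow> 'a measure) \<Rightarrow> bool" where
  "IMS X f \<mu> \<longleftrightarrow>
     (\<forall>n. prob_space (\<mu> n) \<and> sets (\<mu> n) = sets (metric_borel (X n)) \<and>
          distr (\<mu> n) (metric_borel (X (Suc n))) (f n) = \<mu> (Suc n))"

text \<open>
  Partitions are sets of nonempty blocks, so the number \<open>k\<^sub>n\<close> of blocks is \<open>card (P n)\<close>, and the
  compact sets are indexed by the blocks themselves.
\<close>

definition finite_borel_partition :: "'a metric \<Rightarrow> 'a set set \<Rightarrow> bool" where
  "finite_borel_partition X P \<longleftrightarrow>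
     finite P \<and> partition_on (mspace X) P \<and> P \<subseteq> sets (metric_borel X)"

definition admissible ::
  "(nat \<Rightarrow> 'a metric) \<Rightarrow> (nat \<Rightarrow> 'a measure) \<Rightarrow> (nat \<Rightarrow> 'a set set) set" where
  "admissible X \<mu> = {P.
     (\<forall>n. finite_borel_partition (X n) (P n)) \<and>
     (\<exists>N. \<forall>n. card (P n) \<le> N) \<and>
     (\<forall>\<epsilon>>0. \<exists>\<delta>>0. \<exists>K :: nat \<Rightarrow> 'a set \<Rightarrow> 'a set. \<forall>n.
        (\<forall>A\<in>P n. K n A \<subseteq> A \<and> compactin (mtopology_of (X n)) (K n A) \<and>
                  measure (\<mu> n) (A - K n A) \<le> \<epsilon>) \<and>
        (\<forall>A\<in>P n. \<forall>B\<in>P n. A \<noteq> B \<longrightarrow>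
           (\<forall>x\<in>K n A. \<forall>y\<in>K n B. \<delta> \<le> mdist (X n) x y)))}"

definition partition_entropy :: "'a measure \<Rightarrow> 'a set set \<Rightarrow> real" where
  "partition_entropy \<mu> P = - (\<Sum>A\<in>P. measure \<mu> A * ln (measure \<mu> A))"

definition preimage_partition :: "'a set \<Rightarrow> ('a \<Rightarrow> 'b) \<Rightarrow> 'b set set \<Rightarrow> 'a set set" where
  "preimage_partition S h P = (\<lambda>A. h -` A \<inter> S) ` P - {{}}"

definition nds_join ::
  "(nat \<Rightarrow> 'a metric) \<Rightarrow> (nat \<Rightarrow> 'a \<Rightarrow> 'a) \<Rightarrow> (nat \<Rightarrow> 'a set set) \<Rightarrow> nat \<Rightarrow> 'a set set" where
  "nds_join X f P n =
     common_refinement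
       ((\<lambda>i. preimage_partition (mspace (X 0)) (nds_iterate f 0 i) (P i)) ` {..<n})"

definition entropy_wrt ::
  "(nat \<Rightarrow> 'a metric) \<Rightarrow> (nat \<Rightarrow> 'a \<Rightarrow> 'a) \<Rightarrow> (nat \<Rightarrow> 'a measure) \<Rightarrow> (nat \<Rightarrow> 'a set set) \<Rightarrow> ereal" where
  "entropy_wrt X f \<mu> P =
     limsup (\<lambda>n. ereal (partition_entropy (\<mu> 0) (nds_join X f P n) / real n))"

definition metric_entropy ::
  "(nat \<Rightarrow> 'a metric) \<Rightarrow> (nat \<Rightarrow> 'a \<Rightarrow> 'a) \<Rightarrow> (nat \<Rightarrow> 'a measure) \<Rightarrow> ereal" where
  "metric_entropy X f \<mu> = (SUP P\<in>admissible X \<mu>. entropy_wrt X f \<mu> P)"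

text \<open>
  Diameters take values in \<open>ennreal\<close>, because the diameters of the spaces need not be bounded
  uniformly in \<open>n\<close>.
\<close>

definition ediam :: "'a metric \<Rightarrow> 'a set \<Rightarrow> ennreal" where
  "ediam X A = (SUP x\<in>A. SUP y\<in>A. ennreal (mdist X x y))"

definition diam_seq :: "(nat \<Rightarrow> 'a metric) \<Rightarrow> (nat \<Rightarrow> 'a set set) \<Rightarrow> ennreal" where
  "diam_seq X P = (SUP n. SUP A\<in>P n. ediam (X n) A)"

definition fine_scale_IMS ::
  "(nat \<Rightarrow> 'a metric) \<Rightarrow> (nat \<Rightarrow> 'a \<Rightarrow> 'a) \<Rightarrow> (nat \<Rightarrow> 'a measure) \<Rightarrow> bool" where
  "fine_scale_IMS X f \<mu> \<longleftrightarrow>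
     IMS X f \<mu> \<and>
     (\<exists>P :: nat \<Rightarrow> nat \<Rightarrow> 'a set set.
        (\<forall>k. P k \<in> admissible X \<mu>) \<and> (\<lambda>k. diam_seq X (P k)) \<longlonglongrightarrow> 0)"

definition uniformly_totally_bounded :: "(nat \<Rightarrow> 'a metric) \<Rightarrow> bool" where
  "uniformly_totally_bounded X \<longleftrightarrow>
     (\<forall>\<alpha>>0. \<exists>m::nat. \<forall>n. \<exists>C \<subseteq> mspace (X n).
        finite C \<and> card C \<le> m \<and> mspace (X n) \<subseteq> (\<Union>x\<in>C. mball_of (X n) x \<alpha>))"

definition equi_conjugate ::
  "(nat \<Rightarrow> 'a metric) \<Rightarrow> (nat \<Rightarrow> 'a \<Rightarrow> 'a) \<Rightarrow> (nat \<Rightarrow> 'b metric) \<Rightarrow> (nat \<Rightarrow> 'b \<Rightarrow> 'b) \<Rightarrow>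
   (nat \<Rightarrow> 'a \<Rightarrow> 'b) \<Rightarrow> bool" where
  "equi_conjugate X f Y g \<pi> \<longleftrightarrow>
     (\<forall>n. homeomorphic_map (mtopology_of (X n)) (mtopology_of (Y n)) (\<pi> n)) \<and>
     (\<forall>n. \<forall>x\<in>mspace (X n). \<pi> (Suc n) (f n x) = g n (\<pi> n x)) \<and>
     equicontinuous_maps X Y \<pi> \<and>
     equicontinuous_maps Y X (\<lambda>n. inv_into (mspace (X n)) (\<pi> n))"

text \<open>The library's \<open>prod_metric\<close> is the Euclidean product; the maximum metric is needed here.\<close>

definition max_dist :: "'a metric \<Rightarrow> 'b metric \<Rightarrow> 'a \<times> 'b \<Rightarrow> 'a \<times> 'b \<Rightarrow> real" where
  "max_dist X Y p q = max (mdist X (fst p) (fst q)) (mdist Y (snd p) (snd q))"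

definition max_metric :: "'a metric \<Rightarrow> 'b metric \<Rightarrow> ('a \<times> 'b) metric" where
  "max_metric X Y = metric (mspace X \<times> mspace Y, max_dist X Y)"

lemma Metric_space_max_dist: "Metric_space (mspace X \<times> mspace Y) (max_dist X Y)"
proof -
  interpret X: Metric_space "mspace X" "mdist X" by simp
  interpret Y: Metric_space "mspace Y" "mdist Y" by simp
  show ?thesis
  proof
    fix p q r :: "'a \<times> 'b"
    show "0 \<le> max_dist X Y p q"
      by (simp add: max_dist_def le_max_iff_disj)
    show "max_dist X Y p q = max_dist X Y q p"
      by (simp add: max_dist_def X.commute Y.commute)
    assume p: "p \<in> mspace X \<times> mspace Y" and q: "q \<in> mspace X \<times> mspace Y"
    have "max_dist X Y p q = 0 \<longleftrightarrow>
        mdist X (fst p) (fst q) = 0 \<and> mdist Y (snd p) (snd q) = 0"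
      using X.nonneg[of "fst p" "fst q"] Y.nonneg[of "snd p" "snd q"]
      unfolding max_dist_def by linarith
    then show "max_dist X Y p q = 0 \<longleftrightarrow> p = q"
      using p q by (auto simp: prod_eq_iff mem_Times_iff)
    assume r: "r \<in> mspace X \<times> mspace Y"
    show "max_dist X Y p r \<le> max_dist X Y p q + max_dist X Y q r"
      using X.triangle[of "fst p" "fst q" "fst r"] Y.triangle[of "snd p" "snd q" "snd r"] p q r
      unfolding max_dist_def mem_Times_iff by linarith
  qed
qed

lemma mspace_max_metric [simp]: "mspace (max_metric X Y) = mspace X \<times> mspace Y"
  unfolding max_metric_def by (rule Metric_space.mspace_metric[OF Metric_space_max_dist])

lemma mdist_max_metric [simp]: "mdist (max_metric X Y) = max_dist X Y"
  unfolding max_metric_def by (rule Metric_space.mdist_metric[OF Metric_space_max_dist])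

end

theory Submission
  imports Defs
begin

text \<open>
  A partition sequence of small mesh in a fine-scale system has boundedly many blocks, so picking one
  point per block gives uniform total boundedness; conversely, Dirac masses along an orbit are
  fine-scale as soon as the spaces have uniformly finite partitions into small sets.

  For the entropy of a product, let \<open>R\<close> be admissible for the product, with separated compact sets
  \<open>K\<close>, and let \<open>P\<close>, \<open>Q\<close> be admissible for the factors with mesh below the separation. A rectangle
  \<open>B \<times> C\<close> with \<open>B \<in> P n\<close>, \<open>C \<in> Q n\<close> then meets at most one \<open>K n A\<close>, so up to an event of small measure
  the blocks of \<open>P n\<close> and \<open>Q n\<close> determine the block of \<open>R n\<close>. Gibbs' inequality, applied to the
  weights \<open>\<mu>(b) \<nu>(c) \<Prod>\<^sub>i w\<^sub>i(a\<^sub>i | b\<^sub>i, c\<^sub>i)\<close> in which each conditional weight favours the predicted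
  block, bounds the entropy of the join of \<open>R\<close> by those of the joins of \<open>P\<close> and \<open>Q\<close> plus an
  arbitrarily small multiple of the length. No conditional entropy is needed.
\<close>

section \<open>Borel sets and invariant measure sequences\<close>

text \<open>In general no mesh lets the blocks of \<open>P n\<close> and \<open>Q n\<close>
  determine the block of \<open>R n\<close>: small rectangles still straddle boundaries, and this
  can happen at each of the n times. The comparison weights must therefore charge for errors one
  time at a time. A step costs \<open>- ln (1 - \<theta>)\<close>, and at most
  \<open>ln (N / \<theta>)\<close> more when the prediction fails, where \<open>N\<close> bounds the
  number of blocks of \<open>R\<close>. The exceptional event at time i, pulled back to time 0,
  keeps its measure because the measure sequence is invariant. Adding expectations over i then gives
  n times a one-step cost, whatever the dependence between different times, and division by n leaves
  a constant. The penalty \<open>ln (N / \<theta>)\<close> depends on \<open>R\<close> and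
  \<open>e\<close> only. So the constants are fixed in the order \<open>e\<close>,
  \<open>\<theta>\<close>, \<open>\<eta>\<close>, \<open>\<delta>\<close>, and \<open>P\<close> and
  \<open>Q\<close> come last: fine scale supplies them at mesh below any \<open>\<delta>\<close>,
  and the suprema in the metric entropies of the factors absorb their dependence on
  \<open>e\<close>.\<close>

lemma sets_metric_borel_generator: "{U. openin (mtopology_of X) U} \<subseteq> Pow (mspace X)"
  using openin_subset by fastforce

lemma space_metric_borel [simp]: "space (metric_borel X) = mspace X"
  unfolding metric_borel_def by (rule space_measure_of[OF sets_metric_borel_generator])

lemma openin_sets_metric_borel: "openin (mtopology_of X) U \<Longrightarrow> U \<in> sets (metric_borel X)"
  unfolding metric_borel_def by (rule in_measure_of[OF sets_metric_borel_generator]) simp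

lemma closedin_sets_metric_borel:
  assumes "closedin (mtopology_of X) C"
  shows "C \<in> sets (metric_borel X)"
proof -
  have "mspace X - C \<in> sets (metric_borel X)"
    using assms by (intro openin_sets_metric_borel) (metis closedin_def topspace_mtopology_of)
  moreover have "C \<subseteq> mspace X"
    using closedin_subset[OF assms] by simp
  ultimately show ?thesis
    using sets.compl_sets[of "mspace X - C" "metric_borel X"] by (simp add: double_diff)
qed

text \<open>Metric topologies are Hausdorff, so compact sets are closed. This makes the remainders
  \<open>A - K n A\<close> in the definition of admissibility measurable, so that their measures can
  be transported and added.\<close>

lemma compactin_sets_metric_borel:
  assumes "compactin (mtopology_of X) K"
  shows "K \<in> sets (metric_borel X)"
proof -
  interpret Metric_space "mspace X" "mdist X" by simp
  have "Hausdorff_space (mtopology_of X)"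
    unfolding mtopology_of_def by (rule Hausdorff_space_mtopology)
  with assms show ?thesis
    by (intro closedin_sets_metric_borel compactin_imp_closedin)
qed

lemma openin_mball_of: "openin (mtopology_of X) (mball_of X x r)"
  unfolding mtopology_of_def mball_of_def
  by (rule Metric_space.openin_mball) simp

lemma measurable_metric_borel_continuous_map:
  assumes "continuous_map (mtopology_of X) (mtopology_of Y) h"
  shows "h \<in> measurable (metric_borel X) (metric_borel Y)"
  unfolding metric_borel_def[of Y]
proof (rule measurable_measure_of[OF sets_metric_borel_generator])
  show "h \<in> space (metric_borel X) \<rightarrow> mspace Y"
    using continuous_map_funspace[OF assms] by simp
  fix U assume "U \<in> {U. openin (mtopology_of Y) U}"
  then have "openin (mtopology_of X) {x \<in> mspace X. h x \<in> U}"
    using openin_continuous_map_preimage[OF assms] by simp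
  moreover have "h -` U \<inter> space (metric_borel X) = {x \<in> mspace X. h x \<in> U}"
    by auto
  ultimately show "h -` U \<inter> space (metric_borel X) \<in> sets (metric_borel X)"
    by (simp add: openin_sets_metric_borel)
qed

lemma equicontinuous_maps_continuous_map:
  assumes "equicontinuous_maps X Y h"
  shows "continuous_map (mtopology_of (X n)) (mtopology_of (Y n)) (h n)"
proof (rule uniformly_continuous_imp_continuous_map)
  show "uniformly_continuous_map (X n) (Y n) (h n)"
    using assms unfolding equicontinuous_maps_def uniformly_continuous_map_def by meson
qed

lemma topological_NDS_continuous_map:
  assumes "topological_NDS X f"
  shows "continuous_map (mtopology_of (X n)) (mtopology_of (X (Suc n))) (f n)"
  using assms equicontinuous_maps_continuous_map[of X "\<lambda>n. X (Suc n)" f]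
  by (simp add: topological_NDS_def)

lemma continuous_map_nds_iterate:
  assumes "topological_NDS X f"
  shows "continuous_map (mtopology_of (X k)) (mtopology_of (X (k + n))) (nds_iterate f k n)"
proof (induction n)
  case 0
  show ?case
    by (simp add: id_def)
next
  case (Suc n)
  show ?case
    using continuous_map_compose[OF Suc topological_NDS_continuous_map[OF assms, of "k + n"]]
    by (simp only: nds_iterate.simps add_Suc_right)
qed

lemma nds_iterate_in_mspace:
  assumes "topological_NDS X f" "x \<in> mspace (X 0)"
  shows "nds_iterate f 0 n x \<in> mspace (X n)"
  using continuous_map_funspace[OF continuous_map_nds_iterate[OF assms(1), of 0 n]] assms(2) by auto

lemma measurable_nds_iterate:
  assumes "topological_NDS X f"
  shows "nds_iterate f 0 n \<in> measurable (metric_borel (X 0)) (metric_borel (X n))"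
  using measurable_metric_borel_continuous_map[OF continuous_map_nds_iterate[OF assms, of 0 n]] by simp

lemma IMS_prob_space: "IMS X f \<mu> \<Longrightarrow> prob_space (\<mu> n)"
  and IMS_sets: "IMS X f \<mu> \<Longrightarrow> sets (\<mu> n) = sets (metric_borel (X n))"
  and IMS_distr: "IMS X f \<mu> \<Longrightarrow> distr (\<mu> n) (metric_borel (X (Suc n))) (f n) = \<mu> (Suc n)"
  by (auto simp: IMS_def)

lemma IMS_space:
  assumes "IMS X f \<mu>"
  shows "space (\<mu> n) = mspace (X n)"
  using sets_eq_imp_space_eq[OF IMS_sets[OF assms, of n]] by simp

lemma IMS_measurable:
  assumes "IMS X f \<mu>" "h \<in> measurable (metric_borel (X n)) N"
  shows "h \<in> measurable (\<mu> n) N"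
  using assms measurable_cong_sets[OF IMS_sets[OF assms(1)] refl] by auto

text \<open>Joins live at time 0 while admissibility speaks about time n; this lets a bound on an
  event at time n be read at time 0.\<close>

lemma IMS_distr_nds_iterate:
  assumes "topological_NDS X f" "IMS X f \<mu>"
  shows "distr (\<mu> 0) (metric_borel (X n)) (nds_iterate f 0 n) = \<mu> n"
proof (induction n)
  case 0
  show ?case
    by (simp add: id_def distr_id2[OF IMS_sets[OF assms(2), symmetric]])
next
  case (Suc n)
  have "distr (\<mu> 0) (metric_borel (X (Suc n))) (nds_iterate f 0 (Suc n)) =
      distr (distr (\<mu> 0) (metric_borel (X n)) (nds_iterate f 0 n)) (metric_borel (X (Suc n))) (f n)"
    using distr_distr[OF measurable_metric_borel_continuous_map[OF topological_NDS_continuous_map[OF assms(1), of n]]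
        IMS_measurable[OF assms(2) measurable_nds_iterate[OF assms(1)]]]
    by simp
  then show ?case
    using Suc IMS_distr[OF assms(2)] by (simp del: nds_iterate.simps)
qed

section \<open>Fine scale and admissibility in pointwise form\<close>

lemma ediam_le_iff:
  assumes "0 \<le> r"
  shows "ediam X A \<le> ennreal r \<longleftrightarrow> (\<forall>x\<in>A. \<forall>y\<in>A. mdist X x y \<le> r)"
  using assms by (simp add: ediam_def SUP_le_iff ennreal_le_iff)

lemma diam_seq_le_iff:
  assumes "0 \<le> r"
  shows "diam_seq X P \<le> ennreal r \<longleftrightarrow> (\<forall>n. \<forall>A\<in>P n. \<forall>x\<in>A. \<forall>y\<in>A. mdist (X n) x y \<le> r)"
  using assms by (simp add: diam_seq_def SUP_le_iff ediam_le_iff)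

text \<open>Trades the sequence of diameters tending to 0 for one partition sequence per \<epsilon>,
  with a strict bound on distances inside blocks. This is the form in which fine scale is used and
  established everywhere below.\<close>

lemma fine_scale_IMS_iff:
  "fine_scale_IMS X f \<mu> \<longleftrightarrow> IMS X f \<mu> \<and>
     (\<forall>\<epsilon>>0. \<exists>P\<in>admissible X \<mu>. \<forall>n. \<forall>A\<in>P n. \<forall>x\<in>A. \<forall>y\<in>A. mdist (X n) x y < \<epsilon>)"
proof (intro iffI conjI; (elim conjE)?)
  assume fine: "fine_scale_IMS X f \<mu>"
  then show "IMS X f \<mu>"
    by (simp add: fine_scale_IMS_def)
  show "\<forall>\<epsilon>>0. \<exists>P\<in>admissible X \<mu>. \<forall>n. \<forall>A\<in>P n. \<forall>x\<in>A. \<forall>y\<in>A. mdist (X n) x y < \<epsilon>"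
  proof (intro allI impI)
    fix \<epsilon> :: real assume "\<epsilon> > 0"
    obtain P where P: "\<And>k. P k \<in> admissible X \<mu>" "(\<lambda>k. diam_seq X (P k)) \<longlonglongrightarrow> 0"
      using fine unfolding fine_scale_IMS_def by blast
    \<comment> \<open>A bound on a supremum passes to the distances as a non-strict inequality; half
      of \<epsilon> leaves room for the strict one.\<close>
    have "eventually (\<lambda>k. diam_seq X (P k) < ennreal (\<epsilon> / 2)) sequentially"
      using order_tendstoD(2)[OF P(2)] \<open>\<epsilon> > 0\<close> by simp
    then obtain k where "diam_seq X (P k) \<le> ennreal (\<epsilon> / 2)"
      by (meson eventually_happens order_less_imp_le trivial_limit_sequentially)
    then have "\<forall>n. \<forall>A\<in>P k n. \<forall>x\<in>A. \<forall>y\<in>A. mdist (X n) x y \<le> \<epsilon> / 2"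
      using \<open>\<epsilon> > 0\<close> by (simp add: diam_seq_le_iff)
    then show "\<exists>P\<in>admissible X \<mu>. \<forall>n. \<forall>A\<in>P n. \<forall>x\<in>A. \<forall>y\<in>A. mdist (X n) x y < \<epsilon>"
      using P(1)[of k] \<open>\<epsilon> > 0\<close> by (intro bexI[of _ "P k"]) fastforce+
  qed
next
  assume IMS: "IMS X f \<mu>"
    and ex: "\<forall>\<epsilon>>0. \<exists>P\<in>admissible X \<mu>. \<forall>n. \<forall>A\<in>P n. \<forall>x\<in>A. \<forall>y\<in>A. mdist (X n) x y < \<epsilon>"
  have "\<forall>k::nat. \<exists>P\<in>admissible X \<mu>. \<forall>n. \<forall>A\<in>P n. \<forall>x\<in>A. \<forall>y\<in>A. mdist (X n) x y < 1 / Suc k"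
    using ex by simp
  then obtain P where P: "\<And>k::nat. P k \<in> admissible X \<mu>"
    "\<And>k n A x y. A \<in> P k n \<Longrightarrow> x \<in> A \<Longrightarrow> y \<in> A \<Longrightarrow> mdist (X n) x y < 1 / Suc k"
    by metis
  have "diam_seq X (P k) \<le> ennreal (1 / Suc k)" for k
    by (subst diam_seq_le_iff) (simp, intro allI ballI order_less_imp_le P(2))
  moreover have "(\<lambda>k. 1 / real (Suc k)) \<longlonglongrightarrow> 0"
    using LIMSEQ_inverse_real_of_nat by (simp add: inverse_eq_divide)
  then have "(\<lambda>k. ennreal (1 / Suc k)) \<longlonglongrightarrow> ennreal 0"
    by (rule tendsto_ennrealI)
  ultimately have "(\<lambda>k. diam_seq X (P k)) \<longlonglongrightarrow> 0"
    unfolding ennreal_0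
    by (intro tendsto_sandwich[of "\<lambda>_. 0" "\<lambda>k. diam_seq X (P k)" sequentially "\<lambda>k. ennreal (1 / Suc k)"]
        always_eventually allI tendsto_const) simp_all
  then show "fine_scale_IMS X f \<mu>"
    using IMS P(1) unfolding fine_scale_IMS_def by blast
qed

lemma admissibleI:
  assumes "\<And>n. finite_borel_partition (X n) (P n)" and "\<And>n. card (P n) \<le> N"
    and "\<And>\<epsilon>. \<epsilon> > 0 \<Longrightarrow> \<exists>\<delta>>0. \<exists>K :: nat \<Rightarrow> 'a set \<Rightarrow> 'a set. \<forall>n.
        (\<forall>A\<in>P n. K n A \<subseteq> A \<and> compactin (mtopology_of (X n)) (K n A) \<and>
                  measure (\<mu> n) (A - K n A) \<le> \<epsilon>) \<and>
        (\<forall>A\<in>P n. \<forall>B\<in>P n. A \<noteq> B \<longrightarrow>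
           (\<forall>x\<in>K n A. \<forall>y\<in>K n B. \<delta> \<le> mdist (X n) x y))"
  shows "P \<in> admissible X \<mu>"
  unfolding admissible_def mem_Collect_eq
proof (intro conjI)
  show "\<forall>n. finite_borel_partition (X n) (P n)"
    using assms(1) by (rule allI)
  show "\<exists>N. \<forall>n. card (P n) \<le> N"
    using assms(2) by blast
qed (intro allI impI, rule assms(3))

lemma admissibleE:
  assumes "P \<in> admissible X \<mu>" "\<epsilon> > 0"
  obtains \<delta> K where "\<delta> > 0" "\<And>n A. A \<in> P n \<Longrightarrow> K n A \<subseteq> A"
    "\<And>n A. A \<in> P n \<Longrightarrow> compactin (mtopology_of (X n)) (K n A)"
    "\<And>n A. A \<in> P n \<Longrightarrow> measure (\<mu> n) (A - K n A) \<le> \<epsilon>"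
    "\<And>n A B x y. A \<in> P n \<Longrightarrow> B \<in> P n \<Longrightarrow> A \<noteq> B \<Longrightarrow> x \<in> K n A \<Longrightarrow> y \<in> K n B \<Longrightarrow> \<delta> \<le> mdist (X n) x y"
proof -
  have "\<exists>\<delta>>0. \<exists>K :: nat \<Rightarrow> 'a set \<Rightarrow> 'a set. \<forall>n.
        (\<forall>A\<in>P n. K n A \<subseteq> A \<and> compactin (mtopology_of (X n)) (K n A) \<and>
                  measure (\<mu> n) (A - K n A) \<le> \<epsilon>) \<and>
        (\<forall>A\<in>P n. \<forall>B\<in>P n. A \<noteq> B \<longrightarrow>
           (\<forall>x\<in>K n A. \<forall>y\<in>K n B. \<delta> \<le> mdist (X n) x y))"
    using assms unfolding admissible_def by blast
  then obtain \<delta> K where "\<delta> > 0" and K: "\<forall>n. (\<forall>A\<in>P n. K n A \<subseteq> A \<and>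
      compactin (mtopology_of (X n)) (K n A) \<and> measure (\<mu> n) (A - K n A) \<le> \<epsilon>) \<and>
      (\<forall>A\<in>P n. \<forall>B\<in>P n. A \<noteq> B \<longrightarrow> (\<forall>x\<in>K n A. \<forall>y\<in>K n B. \<delta> \<le> mdist (X n) x y))"
    by (elim exE conjE) (rule that)
  show thesis
    by (rule that[of \<delta> K]) (use \<open>\<delta> > 0\<close> K in simp_all)
qed

lemma admissible_partition: "P \<in> admissible X \<mu> \<Longrightarrow> finite_borel_partition (X n) (P n)"
  and admissible_card_bounded: "P \<in> admissible X \<mu> \<Longrightarrow> \<exists>N. \<forall>n. card (P n) \<le> N"
  unfolding admissible_def by simp_all

section \<open>Uniform total boundedness and equi-conjugacy\<close>

lemma finite_borel_partition_subset:
  assumes "finite_borel_partition X P" "A \<in> P"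
  shows "A \<subseteq> mspace X" "A \<in> sets (metric_borel X)" "A \<noteq> {}"
  using assms partition_onD1 partition_onD3 unfolding finite_borel_partition_def by blast+

lemma finite_borel_partition_covers:
  assumes "finite_borel_partition X P" "x \<in> mspace X"
  obtains A where "A \<in> P" "x \<in> A"
  using assms partition_onD1 unfolding finite_borel_partition_def by blast

lemma finite_borel_partition_unique:
  assumes "finite_borel_partition X P" "A \<in> P" "B \<in> P" "x \<in> A" "x \<in> B"
  shows "A = B"
  using assms partition_onD2[of "mspace X" P] unfolding finite_borel_partition_def disjoint_def by blast

lemma fine_scale_IMS_imp_uniformly_totally_bounded:
  assumes "fine_scale_IMS X f \<mu>"
  shows "uniformly_totally_bounded X"
  unfolding uniformly_totally_bounded_def
proof (intro allI impI)
  fix \<alpha> :: real assume "\<alpha> > 0"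
  then obtain P where P: "P \<in> admissible X \<mu>"
    and small: "\<And>n A x y. A \<in> P n \<Longrightarrow> x \<in> A \<Longrightarrow> y \<in> A \<Longrightarrow> mdist (X n) x y < \<alpha>"
    using assms unfolding fine_scale_IMS_iff by meson
  obtain N where N: "\<And>n. card (P n) \<le> N"
    using admissible_card_bounded[OF P] by blast
  note part = admissible_partition[OF P]
  show "\<exists>m. \<forall>n. \<exists>C\<subseteq>mspace (X n). finite C \<and> card C \<le> m \<and>
      mspace (X n) \<subseteq> (\<Union>x\<in>C. mball_of (X n) x \<alpha>)"
  proof (intro exI allI conjI)
    fix n
    \<comment> \<open>Blocks are nonempty, so this is a point of \<open>A\<close>. All points of
      \<open>A\<close> are within \<alpha> of it, so the ball of radius \<alpha> about it covers the
      block.\<close>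
    let ?c = "\<lambda>A. SOME x. x \<in> A"
    have c: "?c A \<in> A" if "A \<in> P n" for A
      using finite_borel_partition_subset(3)[OF part that] some_in_eq by blast
    show "?c ` P n \<subseteq> mspace (X n)"
      using c finite_borel_partition_subset(1)[OF part] by blast
    have fin: "finite (P n)"
      using part[of n] by (simp add: finite_borel_partition_def)
    then show "finite (?c ` P n)"
      by simp
    show "card (?c ` P n) \<le> N"
      using card_image_le[OF fin, of ?c] N[of n] by linarith
    show "mspace (X n) \<subseteq> (\<Union>x\<in>?c ` P n. mball_of (X n) x \<alpha>)"
    proof
      fix x assume x: "x \<in> mspace (X n)"
      then obtain A where A: "A \<in> P n" "x \<in> A"
        using finite_borel_partition_covers[OF part] by blast
      then have "?c A \<in> mspace (X n)" "mdist (X n) (?c A) x < \<alpha>"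
        using c[OF A(1)] finite_borel_partition_subset(1)[OF part A(1)] small[OF A(1)] by auto
      then show "x \<in> (\<Union>x\<in>?c ` P n. mball_of (X n) x \<alpha>)"
        using A(1) x by auto
    qed
  qed
qed

text \<open>Removing from each open ball the earlier ones of an enumeration keeps the pieces Borel
  and creates no additional blocks, so a bound on the number of balls that is uniform in n carries
  over to the partitions.\<close>

lemma finite_borel_partition_into_balls:
  assumes "finite C" "mspace X \<subseteq> (\<Union>x\<in>C. mball_of X x \<alpha>)"
  obtains P where "finite_borel_partition X P" "card P \<le> card C"
    "\<And>A. A \<in> P \<Longrightarrow> \<exists>c\<in>C. A \<subseteq> mball_of X c \<alpha>"
proof -
  obtain h where h: "bij_betw h {0..<card C} C"
    using ex_bij_betw_nat_finite[OF assms(1)] by blast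
  define B where "B i = mball_of X (h i) \<alpha>" for i
  \<comment> \<open>A ball covered by earlier ones leaves the empty set, which may not be a
    block.\<close>
  define P where "P = disjointed B ` {0..<card C} - {{}}"
  have fin: "finite P"
    by (simp add: P_def)
  have B: "B i \<in> sets (metric_borel X)" for i
    unfolding B_def by (intro openin_sets_metric_borel openin_mball_of)
  have "(\<Union>i\<in>{0..<card C}. B i) = mspace X"
  proof
    show "(\<Union>i\<in>{0..<card C}. B i) \<subseteq> mspace X"
      by (auto simp: B_def)
    have "(\<Union>i\<in>{0..<card C}. B i) = (\<Union>x\<in>h ` {0..<card C}. mball_of X x \<alpha>)"
      by (auto simp: B_def)
    then show "mspace X \<subseteq> (\<Union>i\<in>{0..<card C}. B i)"
      using assms(2) bij_betw_imp_surj_on[OF h] by simp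
  qed
  moreover have "\<Union>P = \<Union>(disjointed B ` {0..<card C})"
    unfolding P_def by blast
  ultimately have union: "\<Union>P = mspace X"
    using finite_UN_disjointed_eq[of B "card C"] by simp
  have "partition_on (mspace X) P"
  proof (rule partition_onI)
    show "\<Union>P = mspace X"
      by (rule union)
    show "{} \<notin> P"
      by (simp add: P_def)
    fix p q assume "p \<in> P" "q \<in> P" "p \<noteq> q"
    then obtain i j where "p = disjointed B i" "q = disjointed B j" "i \<noteq> j"
      unfolding P_def by blast
    then show "disjnt p q"
      using disjoint_family_disjointed[of B] by (auto simp: disjoint_family_on_def disjnt_def)
  qed
  moreover have "P \<subseteq> sets (metric_borel X)"
    using B by (auto simp: P_def disjointed_def)
  ultimately have "finite_borel_partition X P"
    using fin by (simp add: finite_borel_partition_def)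
  moreover have "card P \<le> card C"
  proof -
    have "card P \<le> card (disjointed B ` {0..<card C})"
      unfolding P_def by (intro card_mono) auto
    also have "\<dots> \<le> card C"
      using card_image_le[of "{0..<card C}" "disjointed B"] by simp
    finally show ?thesis .
  qed
  moreover have "\<exists>c\<in>C. A \<subseteq> mball_of X c \<alpha>" if A: "A \<in> P" for A
  proof -
    obtain i where i: "i \<in> {0..<card C}" "A = disjointed B i"
      using A unfolding P_def by blast
    then have "A \<subseteq> mball_of X (h i) \<alpha>"
      using disjointed_subset[of B i] by (simp add: B_def)
    moreover have "h i \<in> C"
      using i(1) bij_betwE[OF h] by simp
    ultimately show ?thesis
      by blast
  qed
  ultimately show thesis
    by (rule that)
qed

text \<open>
  The Dirac masses along an orbit are fine-scale: at each time only one block has positive measure,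
  so the compact sets can be taken to be the orbit point in its own block and empty elsewhere, and
  the separation condition is vacuous.
\<close>

lemma uniformly_totally_bounded_imp_fine_scale_IMS:
  assumes nds: "topological_NDS X f" and utb: "uniformly_totally_bounded X"
  shows "\<exists>\<mu>. fine_scale_IMS X f \<mu>"
proof -
  obtain x where x: "x \<in> mspace (X 0)"
    using nds unfolding topological_NDS_def by blast
  define w where "w n = nds_iterate f 0 n x" for n
  have w_in: "w n \<in> mspace (X n)" for n
    unfolding w_def by (rule nds_iterate_in_mspace[OF nds x])
  define \<mu> where "\<mu> n = return (metric_borel (X n)) (w n)" for n
  have "IMS X f \<mu>"
    unfolding IMS_def
  proof (intro allI conjI)
    fix n
    show "prob_space (\<mu> n)"
      unfolding \<mu>_def by (intro prob_space_return) (simp add: w_in)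
    show "sets (\<mu> n) = sets (metric_borel (X n))"
      by (simp add: \<mu>_def)
    have "w (Suc n) = f n (w n)"
      by (simp add: w_def)
    then show "distr (\<mu> n) (metric_borel (X (Suc n))) (f n) = \<mu> (Suc n)"
      unfolding \<mu>_def
      by (simp add: distr_return[OF measurable_metric_borel_continuous_map[OF topological_NDS_continuous_map[OF nds]]] w_in)
  qed
  moreover have "\<exists>P\<in>admissible X \<mu>. \<forall>n. \<forall>A\<in>P n. \<forall>x\<in>A. \<forall>y\<in>A. mdist (X n) x y < \<epsilon>" if \<epsilon>: "\<epsilon> > 0" for \<epsilon>
  proof -
    \<comment> \<open>Two points of one ball are closer than twice its radius, hence the radius
      \<open>\<epsilon> / 2\<close>.\<close>
    obtain m where m: "\<And>n. \<exists>C \<subseteq> mspace (X n). finite C \<and> card C \<le> m \<and>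
        mspace (X n) \<subseteq> (\<Union>x\<in>C. mball_of (X n) x (\<epsilon> / 2))"
      using utb[unfolded uniformly_totally_bounded_def, rule_format, OF half_gt_zero[OF \<epsilon>]] by blast
    have "\<exists>P. finite_borel_partition (X n) P \<and> card P \<le> m \<and>
        (\<forall>A\<in>P. \<exists>c. A \<subseteq> mball_of (X n) c (\<epsilon> / 2))" for n
    proof -
      obtain C where C: "finite C" "card C \<le> m" "mspace (X n) \<subseteq> (\<Union>x\<in>C. mball_of (X n) x (\<epsilon> / 2))"
        using m[of n] by blast
      obtain P where "finite_borel_partition (X n) P" "card P \<le> card C"
          "\<And>A. A \<in> P \<Longrightarrow> \<exists>c\<in>C. A \<subseteq> mball_of (X n) c (\<epsilon> / 2)"
        using finite_borel_partition_into_balls[OF C(1,3)] by blast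
      then show ?thesis
        using C(2) by (meson order_trans)
    qed
    then obtain P where P: "\<And>n. finite_borel_partition (X n) (P n)" "\<And>n. card (P n) \<le> m"
        "\<And>n A. A \<in> P n \<Longrightarrow> \<exists>c. A \<subseteq> mball_of (X n) c (\<epsilon> / 2)"
      by metis
    have "P \<in> admissible X \<mu>"
    proof (rule admissibleI[OF P(1,2)])
      fix \<eta> :: real assume "\<eta> > 0"
      define K where "K n A = A \<inter> {w n}" for n and A :: "'a set"
      have K_compact: "compactin (mtopology_of (X n)) (K n A)" for n A
        by (rule finite_imp_compactin) (auto simp: K_def w_in)
      have K_measure: "measure (\<mu> n) (A - K n A) \<le> \<eta>" if "A \<in> P n" for n A
      proof -
        have "A - K n A \<in> sets (metric_borel (X n))"
          using finite_borel_partition_subset(2)[OF P(1) that] compactin_sets_metric_borel[OF K_compact]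
          by blast
        moreover have "w n \<notin> A - K n A"
          by (simp add: K_def)
        ultimately show ?thesis
          using \<open>\<eta> > 0\<close> by (simp add: \<mu>_def measure_return)
      qed
      have K_sep: "1 \<le> mdist (X n) x y"
        if "A \<in> P n" "B \<in> P n" "A \<noteq> B" "x \<in> K n A" "y \<in> K n B" for n A B x y
        using that finite_borel_partition_unique[OF P(1) that(1,2), of "w n"] by (auto simp: K_def)
      show "\<exists>\<delta>>0. \<exists>K. \<forall>n. (\<forall>A\<in>P n. K n A \<subseteq> A \<and> compactin (mtopology_of (X n)) (K n A) \<and>
          measure (\<mu> n) (A - K n A) \<le> \<eta>) \<and>
          (\<forall>A\<in>P n. \<forall>B\<in>P n. A \<noteq> B \<longrightarrow> (\<forall>x\<in>K n A. \<forall>y\<in>K n B. \<delta> \<le> mdist (X n) x y))"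
      proof (rule exI[of _ 1], rule conjI, simp, rule exI[of _ K], intro allI conjI ballI impI)
        fix n A assume "A \<in> P n"
        then show "K n A \<subseteq> A" "compactin (mtopology_of (X n)) (K n A)" "measure (\<mu> n) (A - K n A) \<le> \<eta>"
          using K_compact K_measure by (auto simp: K_def)
      qed (rule K_sep)
    qed
    moreover have "mdist (X n) x y < \<epsilon>" if A: "A \<in> P n" and xy: "x \<in> A" "y \<in> A" for n A x y
    proof -
      interpret Metric_space "mspace (X n)" "mdist (X n)" by simp
      obtain c where "A \<subseteq> mball_of (X n) c (\<epsilon> / 2)"
        using P(3)[OF A] by blast
      then have "x \<in> mball_of (X n) c (\<epsilon> / 2)" "y \<in> mball_of (X n) c (\<epsilon> / 2)"
        using xy by auto
      then have "c \<in> mspace (X n)" "x \<in> mspace (X n)" "y \<in> mspace (X n)"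
          "mdist (X n) c x < \<epsilon> / 2" "mdist (X n) c y < \<epsilon> / 2"
        by (simp_all only: in_mball_of)
      then show ?thesis
        using triangle'[of x c y] by (simp add: commute)
    qed
    ultimately show ?thesis
      by blast
  qed
  ultimately have "fine_scale_IMS X f \<mu>"
    unfolding fine_scale_IMS_iff by blast
  then show ?thesis
    by blast
qed

section \<open>Transport along an equi-conjugacy\<close>

text \<open>The image is the preimage under the inverse map. Measurability of the inverse is
  essential, since continuous images of Borel sets need not be Borel.\<close>

lemma homeomorphic_map_image_borel:
  assumes hom: "homeomorphic_map (mtopology_of X) (mtopology_of Y) h"
    and inv: "inv_into (mspace X) h \<in> measurable (metric_borel Y) (metric_borel X)"
    and A: "A \<in> sets (metric_borel X)"
  shows "h ` A \<in> sets (metric_borel Y)"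
proof -
  have sub: "A \<subseteq> mspace X"
    using sets.sets_into_space[OF A] by simp
  have inj: "inj_on h (mspace X)" and surj: "h ` mspace X = mspace Y"
    using homeomorphic_imp_injective_map[OF hom] homeomorphic_imp_surjective_map[OF hom] by simp_all
  have "h ` A = inv_into (mspace X) h -` A \<inter> space (metric_borel Y)"
  proof (intro equalityI subsetI)
    fix y assume "y \<in> h ` A"
    then show "y \<in> inv_into (mspace X) h -` A \<inter> space (metric_borel Y)"
      using sub surj inv_into_f_f[OF inj] by auto
  next
    fix y assume y: "y \<in> inv_into (mspace X) h -` A \<inter> space (metric_borel Y)"
    then have "h (inv_into (mspace X) h y) = y"
      using surj by (intro f_inv_into_f) simp
    then show "y \<in> h ` A"
      using y by force
  qed
  then show ?thesis
    using measurable_sets[OF inv A] by simp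
qed

text \<open>The partitions and their compact sets are pushed forward. Equicontinuity of
  \<open>\<pi>\<close> keeps the mesh small and equicontinuity of the inverses keeps the compact
  sets apart, both with constants independent of n; homeomorphisms taken one n at a time would give
  no such uniformity.\<close>

lemma fine_scale_IMS_equi_conjugate:
  assumes X: "topological_NDS X f" and Y: "topological_NDS Y g"
    and conj: "equi_conjugate X f Y g \<pi>" and fine: "fine_scale_IMS X f \<mu>"
  shows "fine_scale_IMS Y g (\<lambda>n. distr (\<mu> n) (metric_borel (Y n)) (\<pi> n))"
    (is "fine_scale_IMS Y g ?\<nu>")
proof -
  have IMS: "IMS X f \<mu>"
    using fine by (simp add: fine_scale_IMS_def)
  have hom: "homeomorphic_map (mtopology_of (X n)) (mtopology_of (Y n)) (\<pi> n)" for n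
    using conj by (simp add: equi_conjugate_def)
  have commutes: "\<pi> (Suc n) (f n x) = g n (\<pi> n x)" if "x \<in> mspace (X n)" for n x
    using conj that by (simp add: equi_conjugate_def)
  have equi: "equicontinuous_maps X Y \<pi>" "equicontinuous_maps Y X (\<lambda>n. inv_into (mspace (X n)) (\<pi> n))"
    using conj by (simp_all add: equi_conjugate_def)
  have inj: "inj_on (\<pi> n) (mspace (X n))" and surj: "\<pi> n ` mspace (X n) = mspace (Y n)" for n
    using homeomorphic_imp_injective_map[OF hom] homeomorphic_imp_surjective_map[OF hom] by simp_all
  have cont: "continuous_map (mtopology_of (X n)) (mtopology_of (Y n)) (\<pi> n)" for n
    by (rule homeomorphic_imp_continuous_map[OF hom])
  have meas: "\<pi> n \<in> measurable (\<mu> n) (metric_borel (Y n))" for n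
    by (intro IMS_measurable[OF IMS] measurable_metric_borel_continuous_map cont)
  have image_sets: "\<pi> n ` A \<in> sets (metric_borel (Y n))" if "A \<in> sets (metric_borel (X n))" for n A
    by (rule homeomorphic_map_image_borel[OF hom _ that])
      (rule measurable_metric_borel_continuous_map[OF equicontinuous_maps_continuous_map[OF equi(2)]])
  have "IMS Y g ?\<nu>"
    unfolding IMS_def
  proof (intro allI conjI)
    fix n
    show "prob_space (?\<nu> n)"
      by (rule prob_space.prob_space_distr[OF IMS_prob_space[OF IMS] meas])
    show "sets (?\<nu> n) = sets (metric_borel (Y n))"
      by simp
    have f_meas: "f n \<in> measurable (\<mu> n) (metric_borel (X (Suc n)))"
      by (intro IMS_measurable[OF IMS] measurable_metric_borel_continuous_map topological_NDS_continuous_map[OF X])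
    have "distr (?\<nu> n) (metric_borel (Y (Suc n))) (g n) = distr (\<mu> n) (metric_borel (Y (Suc n))) (g n \<circ> \<pi> n)"
      by (rule distr_distr[OF measurable_metric_borel_continuous_map[OF topological_NDS_continuous_map[OF Y]] meas])
    also have "\<dots> = distr (\<mu> n) (metric_borel (Y (Suc n))) (\<pi> (Suc n) \<circ> f n)"
      by (intro distr_cong refl) (simp add: commutes IMS_space[OF IMS])
    also have "\<dots> = distr (distr (\<mu> n) (metric_borel (X (Suc n))) (f n)) (metric_borel (Y (Suc n))) (\<pi> (Suc n))"
      by (rule distr_distr[OF measurable_metric_borel_continuous_map[OF cont] f_meas, symmetric])
    also have "\<dots> = ?\<nu> (Suc n)"
      by (simp add: IMS_distr[OF IMS])
    finally show "distr (?\<nu> n) (metric_borel (Y (Suc n))) (g n) = ?\<nu> (Suc n)" .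
  qed
  moreover have "\<exists>Q\<in>admissible Y ?\<nu>. \<forall>n. \<forall>B\<in>Q n. \<forall>x\<in>B. \<forall>y\<in>B. mdist (Y n) x y < \<epsilon>" if "\<epsilon> > 0" for \<epsilon>
  proof -
    obtain \<delta> where "\<delta> > 0" and \<delta>: "\<And>n x y. x \<in> mspace (X n) \<Longrightarrow> y \<in> mspace (X n) \<Longrightarrow>
        mdist (X n) x y < \<delta> \<Longrightarrow> mdist (Y n) (\<pi> n x) (\<pi> n y) < \<epsilon>"
      using equi(1) \<open>\<epsilon> > 0\<close> unfolding equicontinuous_maps_def by meson
    obtain P where P: "P \<in> admissible X \<mu>"
      and small: "\<And>n A x y. A \<in> P n \<Longrightarrow> x \<in> A \<Longrightarrow> y \<in> A \<Longrightarrow> mdist (X n) x y < \<delta>"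
      using fine \<open>\<delta> > 0\<close> unfolding fine_scale_IMS_iff by meson
    note part = admissible_partition[OF P]
    note sub = finite_borel_partition_subset(1)[OF part]
    obtain N where N: "\<And>n. card (P n) \<le> N"
      using admissible_card_bounded[OF P] by blast
    have fin: "finite (P n)" for n
      using part[of n] by (simp add: finite_borel_partition_def)
    define Q where "Q n = (`) (\<pi> n) ` P n" for n
    have inv_image: "inv_into (mspace (X n)) (\<pi> n) ` \<pi> n ` A = A" if "A \<in> P n" for n A
      using inv_into_image_cancel[OF inj sub[OF that]] .
    have "Q \<in> admissible Y ?\<nu>"
    proof (rule admissibleI)
      fix n
      have "partition_on (\<pi> n ` mspace (X n)) (Q n - {{}})"
        unfolding Q_def using part[of n] inj by (intro partition_on_inj_image) (simp_all add: finite_borel_partition_def)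
      moreover have "{} \<notin> Q n"
        using finite_borel_partition_subset(3)[OF part] unfolding Q_def by blast
      ultimately have "partition_on (mspace (Y n)) (Q n)"
        by (simp add: surj)
      then show "finite_borel_partition (Y n) (Q n)"
        using fin image_sets finite_borel_partition_subset(2)[OF part]
        by (auto simp: finite_borel_partition_def Q_def)
      show "card (Q n) \<le> N"
        unfolding Q_def using card_image_le[OF fin] N by (rule order_trans)
    next
      fix \<eta> :: real assume "\<eta> > 0"
      obtain d K where "d > 0" and K: "\<And>n A. A \<in> P n \<Longrightarrow> K n A \<subseteq> A"
        "\<And>n A. A \<in> P n \<Longrightarrow> compactin (mtopology_of (X n)) (K n A)"
        "\<And>n A. A \<in> P n \<Longrightarrow> measure (\<mu> n) (A - K n A) \<le> \<eta>"
        "\<And>n A B x y. A \<in> P n \<Longrightarrow> B \<in> P n \<Longrightarrow> A \<noteq> B \<Longrightarrow> x \<in> K n A \<Longrightarrow> y \<in> K n B \<Longrightarrow> d \<le> mdist (X n) x y"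
        using admissibleE[OF P \<open>\<eta> > 0\<close>] by blast
      obtain e where "e > 0" and e: "\<And>n x y. x \<in> mspace (Y n) \<Longrightarrow> y \<in> mspace (Y n) \<Longrightarrow> mdist (Y n) x y < e \<Longrightarrow>
          mdist (X n) (inv_into (mspace (X n)) (\<pi> n) x) (inv_into (mspace (X n)) (\<pi> n) y) < d"
        using equi(2) \<open>d > 0\<close> unfolding equicontinuous_maps_def by meson
      \<comment> \<open>The compact sets must be indexed by blocks of \<open>Q n\<close>, so the
        block is first carried back to \<open>P n\<close>.\<close>
      define L where "L n B = \<pi> n ` K n (inv_into (mspace (X n)) (\<pi> n) ` B)" for n B
      have L: "L n (\<pi> n ` A) = \<pi> n ` K n A" if "A \<in> P n" for n A
        using inv_image[OF that] by (simp add: L_def)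
      have L_measure: "measure (?\<nu> n) (\<pi> n ` A - \<pi> n ` K n A) \<le> \<eta>" if A: "A \<in> P n" for n A
      proof -
        have sets: "A - K n A \<in> sets (metric_borel (X n))"
          using finite_borel_partition_subset(2)[OF part A] compactin_sets_metric_borel[OF K(2)[OF A]] by blast
        have diff: "\<pi> n ` A - \<pi> n ` K n A = \<pi> n ` (A - K n A)"
          by (rule inj_on_image_set_diff[OF inj, symmetric]) (use sub[OF A] K(1)[OF A] in blast)+
        have "\<pi> n -` (\<pi> n ` (A - K n A)) \<inter> mspace (X n) = A - K n A"
          using sub[OF A] inj[of n] by (auto dest: inj_onD)
        then have "measure (?\<nu> n) (\<pi> n ` (A - K n A)) = measure (\<mu> n) (A - K n A)"
          using measure_distr[OF meas image_sets[OF sets]] by (simp add: IMS_space[OF IMS])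
        then show ?thesis
          using K(3)[OF A] diff by simp
      qed
      have L_sep: "e \<le> mdist (Y n) x y"
        if AB: "A \<in> P n" "B \<in> P n" "\<pi> n ` A \<noteq> \<pi> n ` B" and xy: "x \<in> \<pi> n ` K n A" "y \<in> \<pi> n ` K n B" for n A B x y
      proof -
        obtain u v where uv: "u \<in> K n A" "v \<in> K n B" "x = \<pi> n u" "y = \<pi> n v"
          using xy by blast
        then have "u \<in> mspace (X n)" "v \<in> mspace (X n)"
          using K(1) AB(1,2) sub by blast+
        moreover have "d \<le> mdist (X n) u v"
          using K(4)[OF AB(1,2) _ uv(1,2)] AB(3) by blast
        \<comment> \<open>Contrapositive of the choice of \<open>e\<close>: images closer than
          \<open>e\<close> would have preimages closer than \<open>d\<close>.\<close>
        ultimately show ?thesis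
          using e[of x n y] surj[of n] inv_into_f_f[OF inj] uv(3,4) by fastforce
      qed
      have "(\<forall>B\<in>Q n. L n B \<subseteq> B \<and> compactin (mtopology_of (Y n)) (L n B) \<and> measure (?\<nu> n) (B - L n B) \<le> \<eta>) \<and>
          (\<forall>A\<in>Q n. \<forall>B\<in>Q n. A \<noteq> B \<longrightarrow> (\<forall>x\<in>L n A. \<forall>y\<in>L n B. e \<le> mdist (Y n) x y))" for n
        unfolding Q_def ball_simps
        using L K(1) image_compactin[OF K(2) cont] L_measure L_sep by (simp add: image_mono)
      then show "\<exists>\<delta>>0. \<exists>L. \<forall>n. (\<forall>B\<in>Q n. L n B \<subseteq> B \<and> compactin (mtopology_of (Y n)) (L n B) \<and>
          measure (?\<nu> n) (B - L n B) \<le> \<eta>) \<and>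
          (\<forall>A\<in>Q n. \<forall>B\<in>Q n. A \<noteq> B \<longrightarrow> (\<forall>x\<in>L n A. \<forall>y\<in>L n B. \<delta> \<le> mdist (Y n) x y))"
        using \<open>e > 0\<close> by blast
    qed
    moreover have "\<forall>n. \<forall>B\<in>Q n. \<forall>x\<in>B. \<forall>y\<in>B. mdist (Y n) x y < \<epsilon>"
      unfolding Q_def ball_simps using \<delta> small sub by blast
    ultimately show ?thesis
      by blast
  qed
  ultimately show ?thesis
    unfolding fine_scale_IMS_iff by blast
qed

section \<open>Products with the maximum metric\<close>

text \<open>The maximum of two distances is at most their Euclidean combination, so the identity is
  1-Lipschitz from \<open>prod_metric\<close>, whose topology is the product topology. Compact
  rectangles are thereby compact for the maximum metric, as continuous images.\<close>

lemma continuous_map_prod_topology_max_metric: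
  "continuous_map (prod_topology (mtopology_of X) (mtopology_of Y)) (mtopology_of (max_metric X Y)) (\<lambda>p. p)"
proof -
  have "Lipschitz_continuous_map (prod_metric X Y) (max_metric X Y) (\<lambda>p. p)"
    unfolding Lipschitz_continuous_map_def
  proof (intro conjI exI[of _ 1] ballI)
    fix p q :: "'a \<times> 'b"
    show "mdist (max_metric X Y) p q \<le> 1 * mdist (prod_metric X Y) p q"
      by (cases p; cases q)
        (auto simp: max_dist_def prod_dist_def intro: real_le_rsqrt)
  qed auto
  from Lipschitz_continuous_imp_continuous_map[OF this] show ?thesis
    by simp
qed

lemma compactin_Times_max_metric:
  assumes "compactin (mtopology_of X) S" "compactin (mtopology_of Y) T"
  shows "compactin (mtopology_of (max_metric X Y)) (S \<times> T)"
  using image_compactin[OF _ continuous_map_prod_topology_max_metric, of X Y "S \<times> T"] assms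
  by (simp add: compactin_Times)

lemma continuous_map_max_metric_fst:
  "continuous_map (mtopology_of (max_metric X Y)) (mtopology_of X) fst"
  by (rule Lipschitz_continuous_imp_continuous_map)
    (auto simp: Lipschitz_continuous_map_def max_dist_def intro!: exI[of _ 1])

lemma continuous_map_max_metric_snd:
  "continuous_map (mtopology_of (max_metric X Y)) (mtopology_of Y) snd"
  by (rule Lipschitz_continuous_imp_continuous_map)
    (auto simp: Lipschitz_continuous_map_def max_dist_def intro!: exI[of _ 1])

lemma topological_NDS_max_metric:
  assumes "topological_NDS X f" "topological_NDS Y g"
  shows "topological_NDS (\<lambda>n. max_metric (X n) (Y n)) (\<lambda>n. map_prod (f n) (g n))"
  unfolding topological_NDS_def
proof (intro conjI allI)
  fix n
  show "mspace (max_metric (X n) (Y n)) \<noteq> {}"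
    using assms by (simp add: topological_NDS_def)
  show "compact_space (mtopology_of (max_metric (X n) (Y n)))"
    using assms compactin_Times_max_metric[of "X n" "mspace (X n)" "Y n" "mspace (Y n)"]
    by (simp add: topological_NDS_def compact_space_def)
next
  have fg: "equicontinuous_maps X (\<lambda>n. X (Suc n)) f" "equicontinuous_maps Y (\<lambda>n. Y (Suc n)) g"
    using assms by (simp_all add: topological_NDS_def)
  show "equicontinuous_maps (\<lambda>n. max_metric (X n) (Y n)) (\<lambda>n. max_metric (X (Suc n)) (Y (Suc n)))
      (\<lambda>n. map_prod (f n) (g n))"
    unfolding equicontinuous_maps_def
  proof (intro conjI allI impI)
    fix n
    show "map_prod (f n) (g n) \<in> mspace (max_metric (X n) (Y n)) \<rightarrow> mspace (max_metric (X (Suc n)) (Y (Suc n)))"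
      using fg by (auto simp: equicontinuous_maps_def Pi_iff)
  next
    fix \<epsilon> :: real assume "\<epsilon> > 0"
    obtain d1 where d1: "d1 > 0" "\<And>n x y. x \<in> mspace (X n) \<Longrightarrow> y \<in> mspace (X n) \<Longrightarrow>
        mdist (X n) x y < d1 \<Longrightarrow> mdist (X (Suc n)) (f n x) (f n y) < \<epsilon>"
      using fg(1) \<open>\<epsilon> > 0\<close> unfolding equicontinuous_maps_def by meson
    obtain d2 where d2: "d2 > 0" "\<And>n x y. x \<in> mspace (Y n) \<Longrightarrow> y \<in> mspace (Y n) \<Longrightarrow>
        mdist (Y n) x y < d2 \<Longrightarrow> mdist (Y (Suc n)) (g n x) (g n y) < \<epsilon>"
      using fg(2) \<open>\<epsilon> > 0\<close> unfolding equicontinuous_maps_def by meson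
    show "\<exists>\<delta>>0. \<forall>n. \<forall>x\<in>mspace (max_metric (X n) (Y n)). \<forall>y\<in>mspace (max_metric (X n) (Y n)).
        mdist (max_metric (X n) (Y n)) x y < \<delta> \<longrightarrow>
        mdist (max_metric (X (Suc n)) (Y (Suc n))) (map_prod (f n) (g n) x) (map_prod (f n) (g n) y) < \<epsilon>"
      using d1 d2 by (intro exI[of _ "min d1 d2"]) (auto simp: max_dist_def)
  qed
qed

section \<open>Borel sets of a product of compact metric spaces\<close>

text \<open>The dense set is the union of finite nets of radius \<open>1 / Suc k\<close>, which
  compactness provides through total boundedness.\<close>

lemma compact_metric_countable_dense:
  assumes "compact_space (mtopology_of X)"
  obtains D where "countable D" "D \<subseteq> mspace X"
    "\<And>x e. x \<in> mspace X \<Longrightarrow> e > 0 \<Longrightarrow> \<exists>c\<in>D. mdist X c x < e"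
proof -
  interpret Metric_space "mspace X" "mdist X" by simp
  have "mtotally_bounded (mspace X)"
    using assms compactin_imp_mtotally_bounded[of "mspace X"]
    by (simp add: compact_space_def mtopology_of_def)
  then have "\<exists>K. finite K \<and> K \<subseteq> mspace X \<and> mspace X \<subseteq> (\<Union>x\<in>K. mball x (1 / Suc k))" for k
    unfolding mtotally_bounded_def by simp
  then obtain K where K: "\<And>k. finite (K k)" "\<And>k. K k \<subseteq> mspace X"
      "\<And>k. mspace X \<subseteq> (\<Union>x\<in>K k. mball x (1 / Suc k))"
    by metis
  show thesis
  proof (rule that)
    show "countable (\<Union>k. K k)"
      using K(1) by (intro countable_UN) (auto intro: countable_finite)
    show "(\<Union>k. K k) \<subseteq> mspace X"
      using K(2) by blast
    fix x and e :: real assume x: "x \<in> mspace X" and "e > 0"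
    then obtain k where k: "1 / Suc k < e"
      by (metis nat_approx_posE)
    obtain c where "c \<in> K k" "mdist X c x < 1 / Suc k"
      using K(3)[of k] x by auto
    then show "\<exists>c\<in>\<Union>k. K k. mdist X c x < e"
      using k by force
  qed
qed

lemma mball_of_max_metric: "mball_of (max_metric X Y) (x, y) r = mball_of X x r \<times> mball_of Y y r"
  by (auto simp: max_dist_def)

text \<open>An open set is a countable union of balls with centres in a countable dense set and
  radii \<open>1 / Suc k\<close>, and balls of the maximum metric are rectangles. Conversely, a
  rectangle is an intersection of preimages under the continuous projections. Without separability
  the Borel sets of the product can be strictly more than the product sigma-algebra.\<close>

lemma sets_metric_borel_max_metric:
  assumes X: "compact_space (mtopology_of X)" and Y: "compact_space (mtopology_of Y)"
  shows "sets (metric_borel (max_metric X Y)) = sets (metric_borel X \<Otimes>\<^sub>M metric_borel Y)"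
proof
  interpret Metric_space "mspace (max_metric X Y)" "mdist (max_metric X Y)" by (rule Metric_space_mspace_mdist)
  obtain D where D: "countable D" "D \<subseteq> mspace X"
      "\<And>x e. x \<in> mspace X \<Longrightarrow> e > 0 \<Longrightarrow> \<exists>c\<in>D. mdist X c x < e"
    using compact_metric_countable_dense[OF X] by blast
  obtain E where E: "countable E" "E \<subseteq> mspace Y"
      "\<And>x e. x \<in> mspace Y \<Longrightarrow> e > 0 \<Longrightarrow> \<exists>c\<in>E. mdist Y c x < e"
    using compact_metric_countable_dense[OF Y] by blast
  have "U \<in> sets (metric_borel X \<Otimes>\<^sub>M metric_borel Y)" if U: "openin (mtopology_of (max_metric X Y)) U" for U
  proof -
    define I where "I = {(c, d, k::nat). c \<in> D \<and> d \<in> E \<and> mball_of (max_metric X Y) (c, d) (1 / Suc k) \<subseteq> U}"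
    have "I \<subseteq> D \<times> E \<times> UNIV"
      by (auto simp: I_def)
    then have "countable I"
      by (rule countable_subset) (intro countable_SIGMA D E, simp)
    have "U = (\<Union>(c, d, k)\<in>I. mball_of (max_metric X Y) (c, d) (1 / Suc k))"
    proof (intro equalityI subsetI)
      fix p assume p: "p \<in> U"
      obtain x y where xy: "p = (x, y)"
        by (cases p)
      obtain r where "r > 0" and r: "mball_of (max_metric X Y) p r \<subseteq> U"
        using U p unfolding mtopology_of_def openin_mtopology mball_of_def by blast
      \<comment> \<open>The approximating centre is within \<open>1 / Suc k\<close> of
        \<open>p\<close>, so its ball of that radius stays within \<open>2 / Suc k\<close> of
        \<open>p\<close>.\<close>
      obtain k where "1 / Suc k < r / 2"
        using \<open>r > 0\<close> by (metis nat_approx_posE half_gt_zero)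
      have p_in: "p \<in> mspace (max_metric X Y)"
        using openin_subset[OF U] p by auto
      then have "x \<in> mspace X" "y \<in> mspace Y"
        by (simp_all add: xy)
      then obtain c d where cd: "c \<in> D" "mdist X c x < 1 / Suc k" "d \<in> E" "mdist Y d y < 1 / Suc k"
        using D(3)[of x "1 / Suc k"] E(3)[of y "1 / Suc k"] by auto
      then have near: "mdist (max_metric X Y) (c, d) p < 1 / Suc k" and c_in: "(c, d) \<in> mspace (max_metric X Y)"
        using D(2) E(2) by (auto simp: xy max_dist_def)
      have "mball_of (max_metric X Y) (c, d) (1 / Suc k) \<subseteq> mball_of (max_metric X Y) p r"
      proof
        fix q assume "q \<in> mball_of (max_metric X Y) (c, d) (1 / Suc k)"
        then have "q \<in> mspace (max_metric X Y)" "mdist (max_metric X Y) (c, d) q < 1 / Suc k"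
          by (simp_all only: in_mball_of)
        then show "q \<in> mball_of (max_metric X Y) p r"
          unfolding in_mball_of
          using triangle'[of p "(c, d)" q] triangle''[of p "(c, d)" q] near c_in p_in \<open>1 / Suc k < r / 2\<close>
            commute[of "(c, d)" p] commute[of "(c, d)" q]
          by linarith
      qed
      then have "(c, d, k) \<in> I"
        using cd r by (simp only: I_def mem_Collect_eq split_beta fst_conv snd_conv) blast
      moreover have "p \<in> mball_of (max_metric X Y) (c, d) (1 / Suc k)"
        using near c_in p_in by (simp only: in_mball_of)
      ultimately show "p \<in> (\<Union>(c, d, k)\<in>I. mball_of (max_metric X Y) (c, d) (1 / Suc k))"
        by blast
    qed (unfold I_def, blast)
    moreover have "mball_of (max_metric X Y) (c, d) r \<in> sets (metric_borel X \<Otimes>\<^sub>M metric_borel Y)" for c d r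
      unfolding mball_of_max_metric by (intro pair_measureI openin_sets_metric_borel openin_mball_of)
    then have "(\<Union>(c, d, k)\<in>I. mball_of (max_metric X Y) (c, d) (1 / Suc k)) \<in> sets (metric_borel X \<Otimes>\<^sub>M metric_borel Y)"
      by (intro sets.countable_UN'[OF \<open>countable I\<close>]) auto
    ultimately show ?thesis
      by (simp only:)
  qed
  then have "sigma_sets (space (metric_borel X \<Otimes>\<^sub>M metric_borel Y)) {U. openin (mtopology_of (max_metric X Y)) U}
      \<subseteq> sets (metric_borel X \<Otimes>\<^sub>M metric_borel Y)"
    by (intro sets.sigma_sets_subset) blast
  then show "sets (metric_borel (max_metric X Y)) \<subseteq> sets (metric_borel X \<Otimes>\<^sub>M metric_borel Y)"
    unfolding metric_borel_def[of "max_metric X Y"] sets_measure_of[OF sets_metric_borel_generator]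
    by (simp add: space_pair_measure)
next
  have "A \<times> B \<in> sets (metric_borel (max_metric X Y))"
    if A: "A \<in> sets (metric_borel X)" and B: "B \<in> sets (metric_borel Y)" for A B
  proof -
    note meas = measurable_metric_borel_continuous_map[OF continuous_map_max_metric_fst]
      measurable_metric_borel_continuous_map[OF continuous_map_max_metric_snd]
    have eq: "A \<times> B = (fst -` A \<inter> space (metric_borel (max_metric X Y))) \<inter> (snd -` B \<inter> space (metric_borel (max_metric X Y)))"
      using sets.sets_into_space[OF A] sets.sets_into_space[OF B] by auto
    then show ?thesis
      unfolding eq by (intro sets.Int measurable_sets[OF meas(1) A] measurable_sets[OF meas(2) B])
  qed
  then have "sigma_sets (space (metric_borel (max_metric X Y)))
      {A \<times> B |A B. A \<in> sets (metric_borel X) \<and> B \<in> sets (metric_borel Y)} \<subseteq> sets (metric_borel (max_metric X Y))"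
    by (intro sets.sigma_sets_subset) blast
  then show "sets (metric_borel X \<Otimes>\<^sub>M metric_borel Y) \<subseteq> sets (metric_borel (max_metric X Y))"
    by (simp add: sets_pair_measure)
qed

section \<open>Product measures and product partitions\<close>

lemma measure_pair_measure_Times:
  assumes "sigma_finite_measure N" "A \<in> sets M" "B \<in> sets N"
  shows "measure (M \<Otimes>\<^sub>M N) (A \<times> B) = measure M A * measure N B"
  using sigma_finite_measure.emeasure_pair_measure_Times[OF assms]
  by (simp add: measure_def enn2real_mult)

lemma prob_space_pair_measure:
  assumes "prob_space M" "prob_space N"
  shows "prob_space (M \<Otimes>\<^sub>M N)"
proof -
  interpret M: prob_space M by fact
  interpret N: prob_space N by fact
  show ?thesis
    by (rule prob_spaceI)
      (simp add: space_pair_measure N.emeasure_pair_measure_Times M.emeasure_space_1 N.emeasure_space_1)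
qed

lemma IMS_max_metric:
  assumes X: "topological_NDS X f" and Y: "topological_NDS Y g" and \<mu>: "IMS X f \<mu>" and \<nu>: "IMS Y g \<nu>"
  shows "IMS (\<lambda>n. max_metric (X n) (Y n)) (\<lambda>n. map_prod (f n) (g n)) (\<lambda>n. \<mu> n \<Otimes>\<^sub>M \<nu> n)"
  unfolding IMS_def
proof (intro allI conjI)
  fix n
  have sets: "sets (metric_borel (max_metric (X n) (Y n))) = sets (metric_borel (X n) \<Otimes>\<^sub>M metric_borel (Y n))" for n
    using X Y by (intro sets_metric_borel_max_metric) (simp_all add: topological_NDS_def)
  show "prob_space (\<mu> n \<Otimes>\<^sub>M \<nu> n)"
    by (rule prob_space_pair_measure[OF IMS_prob_space[OF \<mu>] IMS_prob_space[OF \<nu>]])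
  show "sets (\<mu> n \<Otimes>\<^sub>M \<nu> n) = sets (metric_borel (max_metric (X n) (Y n)))"
    unfolding sets by (rule sets_pair_measure_cong[OF IMS_sets[OF \<mu>] IMS_sets[OF \<nu>]])
  have f: "f n \<in> measurable (\<mu> n) (metric_borel (X (Suc n)))"
    by (intro IMS_measurable[OF \<mu>] measurable_metric_borel_continuous_map topological_NDS_continuous_map[OF X])
  have g: "g n \<in> measurable (\<nu> n) (metric_borel (Y (Suc n)))"
    by (intro IMS_measurable[OF \<nu>] measurable_metric_borel_continuous_map topological_NDS_continuous_map[OF Y])
  interpret g: prob_space "distr (\<nu> n) (metric_borel (Y (Suc n))) (g n)"
    by (rule prob_space.prob_space_distr[OF IMS_prob_space[OF \<nu>] g])
  \<comment> \<open>Push-forwards and products commute over the product sigma-algebra, so the Borel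
    sets of the maximum metric are replaced first.\<close>
  have "distr (\<mu> n \<Otimes>\<^sub>M \<nu> n) (metric_borel (max_metric (X (Suc n)) (Y (Suc n)))) (map_prod (f n) (g n)) =
      distr (\<mu> n \<Otimes>\<^sub>M \<nu> n) (metric_borel (X (Suc n)) \<Otimes>\<^sub>M metric_borel (Y (Suc n))) (\<lambda>(x, y). (f n x, g n y))"
    by (intro distr_cong sets) auto
  also have "\<dots> = distr (\<mu> n) (metric_borel (X (Suc n))) (f n) \<Otimes>\<^sub>M distr (\<nu> n) (metric_borel (Y (Suc n))) (g n)"
    by (rule pair_measure_distr[OF f g, symmetric]) (rule g.sigma_finite_measure_axioms)
  also have "\<dots> = \<mu> (Suc n) \<Otimes>\<^sub>M \<nu> (Suc n)"
    by (simp add: IMS_distr[OF \<mu>] IMS_distr[OF \<nu>])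
  finally show "distr (\<mu> n \<Otimes>\<^sub>M \<nu> n) (metric_borel (max_metric (X (Suc n)) (Y (Suc n)))) (map_prod (f n) (g n)) =
      \<mu> (Suc n) \<Otimes>\<^sub>M \<nu> (Suc n)" .
qed

lemma finite_borel_partition_Times:
  assumes X: "compact_space (mtopology_of X)" and Y: "compact_space (mtopology_of Y)"
    and P: "finite_borel_partition X P" and Q: "finite_borel_partition Y Q"
  shows "finite_borel_partition (max_metric X Y) ((\<lambda>(A, B). A \<times> B) ` (P \<times> Q))"
  unfolding finite_borel_partition_def
proof (intro conjI partition_onI)
  show "finite ((\<lambda>(A, B). A \<times> B) ` (P \<times> Q))"
    using P Q by (simp add: finite_borel_partition_def)
  have eq: "mspace X = \<Union>P" "mspace Y = \<Union>Q"
    using P Q partition_onD1 unfolding finite_borel_partition_def by blast+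
  show "\<Union>((\<lambda>(A, B). A \<times> B) ` (P \<times> Q)) = mspace (max_metric X Y)"
    unfolding mspace_max_metric eq by auto
  show "{} \<notin> (\<lambda>(A, B). A \<times> B) ` (P \<times> Q)"
    using finite_borel_partition_subset(3)[OF P] finite_borel_partition_subset(3)[OF Q] by auto
  show "(\<lambda>(A, B). A \<times> B) ` (P \<times> Q) \<subseteq> sets (metric_borel (max_metric X Y))"
    using finite_borel_partition_subset(2)[OF P] finite_borel_partition_subset(2)[OF Q]
    by (auto simp: sets_metric_borel_max_metric[OF X Y])
  fix p q assume "p \<in> (\<lambda>(A, B). A \<times> B) ` (P \<times> Q)" "q \<in> (\<lambda>(A, B). A \<times> B) ` (P \<times> Q)" "p \<noteq> q"
  then obtain A B A' B' where *: "p = A \<times> B" "q = A' \<times> B'" "A \<in> P" "A' \<in> P" "B \<in> Q" "B' \<in> Q" "A \<noteq> A' \<or> B \<noteq> B'"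
    by auto
  show "disjnt p q"
    unfolding disjnt_iff
  proof (intro allI notI)
    fix z assume "z \<in> p \<and> z \<in> q"
    then have "fst z \<in> A" "fst z \<in> A'" "snd z \<in> B" "snd z \<in> B'"
      using *(1,2) by auto
    then show False
      using finite_borel_partition_unique[OF P *(3,4)] finite_borel_partition_unique[OF Q *(5,6)] *(7) by blast
  qed
qed

text \<open>A point of \<open>A \<times> B\<close> outside \<open>K \<times> L\<close> has its first
  coordinate outside \<open>K\<close> or its second outside \<open>L\<close>. This covers the
  difference by two strips, whose other side has measure at most 1.\<close>

lemma measure_Times_Diff_Times_le:
  assumes M: "prob_space M" and N: "prob_space N"
    and A: "A \<in> sets M" "K \<in> sets M" and B: "B \<in> sets N" "L \<in> sets N"
  shows "measure (M \<Otimes>\<^sub>M N) (A \<times> B - K \<times> L) \<le> measure M (A - K) + measure N (B - L)"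
proof -
  interpret M: prob_space M by fact
  interpret N: prob_space N by fact
  interpret MN: prob_space "M \<Otimes>\<^sub>M N" by (rule prob_space_pair_measure[OF M N])
  have "measure (M \<Otimes>\<^sub>M N) (A \<times> B - K \<times> L) \<le> measure (M \<Otimes>\<^sub>M N) ((A - K) \<times> B \<union> A \<times> (B - L))"
    using A B by (intro MN.finite_measure_mono) auto
  also have "\<dots> \<le> measure (M \<Otimes>\<^sub>M N) ((A - K) \<times> B) + measure (M \<Otimes>\<^sub>M N) (A \<times> (B - L))"
    using A B by (intro measure_Un_le) auto
  also have "\<dots> = measure M (A - K) * measure N B + measure M A * measure N (B - L)"
    using A B by (simp add: measure_pair_measure_Times[OF N.sigma_finite_measure_axioms])
  also have "\<dots> \<le> measure M (A - K) + measure N (B - L)"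
    by (intro add_mono mult_left_le mult_left_le_one_le) auto
  finally show ?thesis .
qed

lemma admissible_Times:
  assumes X: "topological_NDS X f" and Y: "topological_NDS Y g" and \<mu>: "IMS X f \<mu>" and \<nu>: "IMS Y g \<nu>"
    and P: "P \<in> admissible X \<mu>" and Q: "Q \<in> admissible Y \<nu>"
  shows "(\<lambda>n. (\<lambda>(A, B). A \<times> B) ` (P n \<times> Q n)) \<in> admissible (\<lambda>n. max_metric (X n) (Y n)) (\<lambda>n. \<mu> n \<Otimes>\<^sub>M \<nu> n)"
proof -
  note pP = admissible_partition[OF P] and pQ = admissible_partition[OF Q]
  have fin: "finite (P n)" "finite (Q n)" for n
    using pP pQ by (simp_all add: finite_borel_partition_def)
  obtain N1 N2 where N: "\<And>n. card (P n) \<le> N1" "\<And>n. card (Q n) \<le> N2"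
    using admissible_card_bounded[OF P] admissible_card_bounded[OF Q] by blast
  show ?thesis
  proof (rule admissibleI)
    fix n
    show "finite_borel_partition (max_metric (X n) (Y n)) ((\<lambda>(A, B). A \<times> B) ` (P n \<times> Q n))"
      using X Y by (intro finite_borel_partition_Times pP pQ) (simp_all add: topological_NDS_def)
    have "card ((\<lambda>(A, B). A \<times> B) ` (P n \<times> Q n)) \<le> card (P n \<times> Q n)"
      using fin by (intro card_image_le) simp
    also have "\<dots> \<le> N1 * N2"
      using N by (simp add: card_cartesian_product mult_le_mono)
    finally show "card ((\<lambda>(A, B). A \<times> B) ` (P n \<times> Q n)) \<le> N1 * N2" .
  next
    fix \<epsilon> :: real assume "\<epsilon> > 0"
    then have e: "\<epsilon> / 2 > 0"
      by simp
    obtain d1 K where d1: "d1 > 0" and K: "\<And>n A. A \<in> P n \<Longrightarrow> K n A \<subseteq> A"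
      "\<And>n A. A \<in> P n \<Longrightarrow> compactin (mtopology_of (X n)) (K n A)"
      "\<And>n A. A \<in> P n \<Longrightarrow> measure (\<mu> n) (A - K n A) \<le> \<epsilon> / 2"
      "\<And>n A B x y. A \<in> P n \<Longrightarrow> B \<in> P n \<Longrightarrow> A \<noteq> B \<Longrightarrow> x \<in> K n A \<Longrightarrow> y \<in> K n B \<Longrightarrow> d1 \<le> mdist (X n) x y"
      using admissibleE[OF P e] by blast
    obtain d2 L where d2: "d2 > 0" and L: "\<And>n A. A \<in> Q n \<Longrightarrow> L n A \<subseteq> A"
      "\<And>n A. A \<in> Q n \<Longrightarrow> compactin (mtopology_of (Y n)) (L n A)"
      "\<And>n A. A \<in> Q n \<Longrightarrow> measure (\<nu> n) (A - L n A) \<le> \<epsilon> / 2"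
      "\<And>n A B x y. A \<in> Q n \<Longrightarrow> B \<in> Q n \<Longrightarrow> A \<noteq> B \<Longrightarrow> x \<in> L n A \<Longrightarrow> y \<in> L n B \<Longrightarrow> d2 \<le> mdist (Y n) x y"
      using admissibleE[OF Q e] by blast
    \<comment> \<open>A block is given only as a set of pairs. Its sides are recovered as
      projections, which is correct because both sides are nonempty.\<close>
    define KL where "KL n C = K n (fst ` C) \<times> L n (snd ` C)" for n C
    have KL: "KL n (A \<times> B) = K n A \<times> L n B" if "A \<in> P n" "B \<in> Q n" for n A B
      using finite_borel_partition_subset(3)[OF pP that(1)] finite_borel_partition_subset(3)[OF pQ that(2)]
      by (simp add: KL_def)
    have small: "measure (\<mu> n \<Otimes>\<^sub>M \<nu> n) (A \<times> B - K n A \<times> L n B) \<le> \<epsilon>" if AB: "A \<in> P n" "B \<in> Q n" for n A B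
    proof -
      have "measure (\<mu> n \<Otimes>\<^sub>M \<nu> n) (A \<times> B - K n A \<times> L n B) \<le> measure (\<mu> n) (A - K n A) + measure (\<nu> n) (B - L n B)"
        using finite_borel_partition_subset(2)[OF pP AB(1)] finite_borel_partition_subset(2)[OF pQ AB(2)]
          compactin_sets_metric_borel[OF K(2)[OF AB(1)]] compactin_sets_metric_borel[OF L(2)[OF AB(2)]]
        by (intro measure_Times_Diff_Times_le IMS_prob_space[OF \<mu>] IMS_prob_space[OF \<nu>])
          (simp_all add: IMS_sets[OF \<mu>] IMS_sets[OF \<nu>])
      then show ?thesis
        using K(3)[OF AB(1)] L(3)[OF AB(2)] by linarith
    qed
    \<comment> \<open>Distinct rectangles differ in at least one side, and the maximum metric
      dominates the distance in that coordinate.\<close>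
    have sep: "min d1 d2 \<le> max_dist (X n) (Y n) (x, y) (x', y')"
      if A: "A \<in> P n" "A' \<in> P n" and B: "B \<in> Q n" "B' \<in> Q n" and ne: "A \<times> B \<noteq> A' \<times> B'"
        and xy: "x \<in> K n A" "y \<in> L n B" "x' \<in> K n A'" "y' \<in> L n B'" for n A A' B B' x x' y y'
    proof -
      have "A \<noteq> A' \<or> B \<noteq> B'"
        using ne by blast
      then have "d1 \<le> mdist (X n) x x' \<or> d2 \<le> mdist (Y n) y y'"
        using K(4)[OF A _ xy(1,3)] L(4)[OF B _ xy(2,4)] by blast
      then show ?thesis
        by (auto simp: max_dist_def)
    qed
    have comp: "compactin (mtopology_of (max_metric (X n) (Y n))) (K n A \<times> L n B)" if "A \<in> P n" "B \<in> Q n" for n A B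
      using that by (intro compactin_Times_max_metric K L)
    show "\<exists>\<delta>>0. \<exists>K. \<forall>n.
        (\<forall>A\<in>(\<lambda>(A, B). A \<times> B) ` (P n \<times> Q n). K n A \<subseteq> A \<and>
            compactin (mtopology_of (max_metric (X n) (Y n))) (K n A) \<and>
            measure (\<mu> n \<Otimes>\<^sub>M \<nu> n) (A - K n A) \<le> \<epsilon>) \<and>
        (\<forall>A\<in>(\<lambda>(A, B). A \<times> B) ` (P n \<times> Q n). \<forall>B\<in>(\<lambda>(A, B). A \<times> B) ` (P n \<times> Q n). A \<noteq> B \<longrightarrow>
            (\<forall>x\<in>K n A. \<forall>y\<in>K n B. \<delta> \<le> mdist (max_metric (X n) (Y n)) x y))"
    proof (intro exI[of _ "min d1 d2"] exI[of _ KL] conjI allI)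
      show "0 < min d1 d2"
        using d1 d2 by simp
      fix n
      show "\<forall>A\<in>(\<lambda>(A, B). A \<times> B) ` (P n \<times> Q n). KL n A \<subseteq> A \<and>
            compactin (mtopology_of (max_metric (X n) (Y n))) (KL n A) \<and>
            measure (\<mu> n \<Otimes>\<^sub>M \<nu> n) (A - KL n A) \<le> \<epsilon>"
        using KL small comp Sigma_mono[OF K(1) L(1)] by auto
      show "\<forall>A\<in>(\<lambda>(A, B). A \<times> B) ` (P n \<times> Q n). \<forall>B\<in>(\<lambda>(A, B). A \<times> B) ` (P n \<times> Q n). A \<noteq> B \<longrightarrow>
            (\<forall>x\<in>KL n A. \<forall>y\<in>KL n B. min d1 d2 \<le> mdist (max_metric (X n) (Y n)) x y)"
        using sep KL by (fastforce simp only: mdist_max_metric)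
    qed
  qed
qed

lemma fine_scale_IMS_max_metric:
  assumes X: "topological_NDS X f" and Y: "topological_NDS Y g"
    and \<mu>: "fine_scale_IMS X f \<mu>" and \<nu>: "fine_scale_IMS Y g \<nu>"
  shows "fine_scale_IMS (\<lambda>n. max_metric (X n) (Y n)) (\<lambda>n. map_prod (f n) (g n)) (\<lambda>n. \<mu> n \<Otimes>\<^sub>M \<nu> n)"
  unfolding fine_scale_IMS_iff
proof (intro conjI allI impI)
  have IMS: "IMS X f \<mu>" "IMS Y g \<nu>"
    using \<mu> \<nu> by (simp_all add: fine_scale_IMS_def)
  show "IMS (\<lambda>n. max_metric (X n) (Y n)) (\<lambda>n. map_prod (f n) (g n)) (\<lambda>n. \<mu> n \<Otimes>\<^sub>M \<nu> n)"
    by (rule IMS_max_metric[OF X Y IMS])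
  fix \<epsilon> :: real assume "\<epsilon> > 0"
  obtain P where P: "P \<in> admissible X \<mu>" "\<And>n A x y. A \<in> P n \<Longrightarrow> x \<in> A \<Longrightarrow> y \<in> A \<Longrightarrow> mdist (X n) x y < \<epsilon>"
    using \<mu> \<open>\<epsilon> > 0\<close> unfolding fine_scale_IMS_iff by meson
  obtain Q where Q: "Q \<in> admissible Y \<nu>" "\<And>n A x y. A \<in> Q n \<Longrightarrow> x \<in> A \<Longrightarrow> y \<in> A \<Longrightarrow> mdist (Y n) x y < \<epsilon>"
    using \<nu> \<open>\<epsilon> > 0\<close> unfolding fine_scale_IMS_iff by meson
  show "\<exists>R\<in>admissible (\<lambda>n. max_metric (X n) (Y n)) (\<lambda>n. \<mu> n \<Otimes>\<^sub>M \<nu> n).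
      \<forall>n. \<forall>A\<in>R n. \<forall>x\<in>A. \<forall>y\<in>A. mdist (max_metric (X n) (Y n)) x y < \<epsilon>"
    by (rule bexI[OF _ admissible_Times[OF X Y IMS P(1) Q(1)]]) (auto simp: max_dist_def P(2) Q(2))
qed

section \<open>Entropy of products\<close>

text \<open>Total probability, stated for an indexed family so that it serves both partitions,
  indexed by their own blocks, and rectangles, indexed by pairs of blocks.\<close>

lemma (in finite_measure) sum_measure_Int_family:
  assumes "finite J" "disjoint_family_on S J" "S ` J \<subseteq> sets M" "space M \<subseteq> (\<Union>j\<in>J. S j)" "T \<in> sets M"
  shows "(\<Sum>j\<in>J. measure M (S j \<inter> T)) = measure M T"
proof -
  have "measure M (\<Union>j\<in>J. S j \<inter> T) = (\<Sum>j\<in>J. measure M (S j \<inter> T))"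
    using assms by (intro finite_measure_finite_Union) (auto simp: disjoint_family_on_def)
  moreover have "(\<Union>j\<in>J. S j \<inter> T) = T"
    using assms(4) sets.sets_into_space[OF assms(5)] by blast
  ultimately show ?thesis
    by simp
qed

text \<open>
  Gibbs' inequality for the joint distribution of the partition \<open>R\<close> and the family \<open>S\<close>, combined
  with the monotonicity of entropy under refinement.
\<close>

lemma (in prob_space) partition_entropy_le_cross_entropy:
  fixes S :: "'j \<Rightarrow> 'a set"
  assumes R: "finite R" "disjoint R" "R \<subseteq> events" "space M \<subseteq> \<Union>R"
    and S: "finite J" "disjoint_family_on S J" "S ` J \<subseteq> events" "space M \<subseteq> (\<Union>j\<in>J. S j)"
    and q_nonneg: "\<And>A j. A \<in> R \<Longrightarrow> j \<in> J \<Longrightarrow> 0 \<le> q A j"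
    and q_pos: "\<And>A j. A \<in> R \<Longrightarrow> j \<in> J \<Longrightarrow> 0 < prob (A \<inter> S j) \<Longrightarrow> 0 < q A j"
    and q_sum: "(\<Sum>A\<in>R. \<Sum>j\<in>J. q A j) \<le> 1"
  shows "partition_entropy M R \<le> (\<Sum>A\<in>R. \<Sum>j\<in>J. prob (A \<inter> S j) * - ln (q A j))"
proof -
  have marginal: "(\<Sum>j\<in>J. prob (A \<inter> S j)) = prob A" if "A \<in> events" for A
    using sum_measure_Int_family[OF S that] by (simp only: Int_commute)
  have total: "(\<Sum>A\<in>R. prob A) = 1"
    using sum_measure_Int_family[of R "\<lambda>A. A" "space M"] R sets.sets_into_space
    by (simp add: disjoint_family_on_def disjoint_def prob_space Int_absorb2 subset_iff)
  \<comment> \<open>The corrections \<open>q A j - prob (A \<inter> S j)\<close> sum to at most 0,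
    because \<open>q\<close> has total mass at most 1 and the joint distribution has mass 1. Where
    the probability is 0, \<open>q\<close> may vanish and its logarithm carries no information, so
    this case is separate.\<close>
  have pointwise: "prob (A \<inter> S j) * - ln (prob A) \<le> prob (A \<inter> S j) * - ln (q A j) + (q A j - prob (A \<inter> S j))"
    if A: "A \<in> R" and j: "j \<in> J" for A j
  proof (cases "prob (A \<inter> S j) = 0")
    case True
    then show ?thesis
      using q_nonneg[OF A j] by simp
  next
    case False
    then have p: "0 < prob (A \<inter> S j)"
      using measure_nonneg[of M "A \<inter> S j"] by linarith
    have q: "0 < q A j"
      by (rule q_pos[OF A j p])
    \<comment> \<open>This is where the entropy of \<open>R\<close> is bounded by that of the finer
      joint partition.\<close>
    have le: "prob (A \<inter> S j) \<le> prob A"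
      using R(3) A by (intro finite_measure_mono) auto
    have "ln (q A j) - ln (prob A) \<le> ln (q A j) - ln (prob (A \<inter> S j))"
      using p le by simp
    also have "\<dots> = ln (q A j / prob (A \<inter> S j))"
      using p q by (simp add: ln_div)
    also have "\<dots> \<le> q A j / prob (A \<inter> S j) - 1"
      using p q by (intro ln_le_minus_one) simp
    finally have "prob (A \<inter> S j) * (ln (q A j) - ln (prob A)) \<le> prob (A \<inter> S j) * (q A j / prob (A \<inter> S j) - 1)"
      using p by (intro mult_left_mono) simp_all
    also have "\<dots> = q A j - prob (A \<inter> S j)"
      using p by (simp add: right_diff_distrib)
    finally show ?thesis
      by (simp add: algebra_simps)
  qed
  have "partition_entropy M R = (\<Sum>A\<in>R. (\<Sum>j\<in>J. prob (A \<inter> S j)) * - ln (prob A))"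
    unfolding partition_entropy_def sum_negf[symmetric] using R(3) marginal by (intro sum.cong) auto
  also have "\<dots> = (\<Sum>A\<in>R. \<Sum>j\<in>J. prob (A \<inter> S j) * - ln (prob A))"
    by (simp only: sum_distrib_right)
  also have "\<dots> \<le> (\<Sum>A\<in>R. \<Sum>j\<in>J. prob (A \<inter> S j) * - ln (q A j) + (q A j - prob (A \<inter> S j)))"
    by (intro sum_mono pointwise)
  also have "\<dots> = (\<Sum>A\<in>R. \<Sum>j\<in>J. prob (A \<inter> S j) * - ln (q A j)) +
      ((\<Sum>A\<in>R. \<Sum>j\<in>J. q A j) - (\<Sum>A\<in>R. \<Sum>j\<in>J. prob (A \<inter> S j)))"
    by (simp only: sum.distrib sum_subtractf)
  also have "(\<Sum>A\<in>R. \<Sum>j\<in>J. prob (A \<inter> S j)) = 1"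
    using R(3) marginal total by (metis (no_types, lifting) subsetD sum.cong)
  finally show ?thesis
    using q_sum by linarith
qed

section \<open>Joins and itineraries\<close>

lemma finite_borel_partition_preimage:
  assumes "h \<in> measurable (metric_borel X) (metric_borel Y)" "finite_borel_partition Y P"
  shows "finite_borel_partition X (preimage_partition (mspace X) h P)"
  unfolding finite_borel_partition_def
proof (intro conjI partition_onI)
  have h: "h x \<in> mspace Y" if "x \<in> mspace X" for x
    using measurable_space[OF assms(1)] that by simp
  show "finite (preimage_partition (mspace X) h P)"
    using assms(2) by (simp add: preimage_partition_def finite_borel_partition_def)
  show "\<Union>(preimage_partition (mspace X) h P) = mspace X"
  proof (intro equalityI subsetI)
    fix x assume x: "x \<in> mspace X"
    then obtain A where "A \<in> P" "h x \<in> A"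
      using finite_borel_partition_covers[OF assms(2) h] by blast
    then show "x \<in> \<Union>(preimage_partition (mspace X) h P)"
      using x unfolding preimage_partition_def by blast
  qed (auto simp: preimage_partition_def)
  show "{} \<notin> preimage_partition (mspace X) h P"
    by (simp add: preimage_partition_def)
  show "preimage_partition (mspace X) h P \<subseteq> sets (metric_borel X)"
    using measurable_sets[OF assms(1)] finite_borel_partition_subset(2)[OF assms(2)]
    by (auto simp: preimage_partition_def)
  fix p q assume "p \<in> preimage_partition (mspace X) h P" "q \<in> preimage_partition (mspace X) h P" "p \<noteq> q"
  then show "disjnt p q"
    using finite_borel_partition_unique[OF assms(2)] unfolding preimage_partition_def disjnt_iff by blast
qed

text \<open>An empty family would have the intersection \<open>UNIV\<close> as its only block;
  excluding it is the source of the condition \<open>0 < n\<close> on the length of joins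
  below.\<close>

lemma finite_borel_partition_common_refinement:
  assumes "finite \<P>" "\<P> \<noteq> {}" and part: "\<And>P. P \<in> \<P> \<Longrightarrow> finite_borel_partition X P"
  shows "finite_borel_partition X (common_refinement \<P>)"
  unfolding finite_borel_partition_def
proof (intro conjI)
  show "finite (common_refinement \<P>)"
    using assms by (intro finite_common_refinement) (simp_all add: finite_borel_partition_def)
  show "partition_on (mspace X) (common_refinement \<P>)"
    using assms by (intro partition_on_common_refinement) (simp_all add: finite_borel_partition_def)
  show "common_refinement \<P> \<subseteq> sets (metric_borel X)"
  proof
    fix A assume "A \<in> common_refinement \<P>"
    then obtain F where F: "\<And>P. P \<in> \<P> \<Longrightarrow> F P \<in> P" "A = \<Inter>(F ` \<P>)"
      by (auto simp: common_refinement)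
    show "A \<in> sets (metric_borel X)"
      unfolding F(2) using F(1) part finite_borel_partition_subset(2) assms(1,2)
      by (intro sets.finite_INT) blast+
  qed
qed

text \<open>\<open>B\<close> is an intersection of one block from each partition, and since
  \<open>B\<close> is nonempty each of these is the only block of its partition that contains
  \<open>B\<close>. By \<open>same\<close> they all contain \<open>A\<close> as well.\<close>

lemma common_refinement_subset:
  assumes part: "\<And>P. P \<in> \<P> \<Longrightarrow> partition_on \<Omega> P"
    and A: "A \<in> common_refinement \<P>" and B: "B \<in> common_refinement \<P>"
    and same: "\<And>P. P \<in> \<P> \<Longrightarrow> \<exists>C\<in>P. A \<subseteq> C \<and> B \<subseteq> C"
  shows "A \<subseteq> B"
proof -
  obtain F where F: "\<And>P. P \<in> \<P> \<Longrightarrow> F P \<in> P" "B = \<Inter>(F ` \<P>)" "B \<noteq> {}"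
    using B by (auto simp: common_refinement)
  have "A \<subseteq> F P" if P: "P \<in> \<P>" for P
  proof -
    obtain C where C: "C \<in> P" "A \<subseteq> C" "B \<subseteq> C"
      using same[OF P] by blast
    have "F P \<inter> C \<noteq> {}"
      using F(2,3) C(3) P by blast
    then have "F P = C"
      using partition_onD2[OF part[OF P]] F(1)[OF P] C(1) by (auto simp: disjoint_def)
    then show ?thesis
      using C(2) by simp
  qed
  then show ?thesis
    using F(2) by blast
qed

lemma finite_borel_partition_nds_join:
  assumes "topological_NDS X f" "\<And>n. finite_borel_partition (X n) (P n)" "0 < n"
  shows "finite_borel_partition (X 0) (nds_join X f P n)"
  unfolding nds_join_def
  using assms by (intro finite_borel_partition_common_refinement)
    (auto intro!: finite_borel_partition_preimage[OF measurable_nds_iterate])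

text \<open>A block of the join is a bare set that does not record which blocks were intersected, so
  they are recovered by choice. Restricting the function to times below n places it in the
  extensional product \<open>PiE\<close>.\<close>

definition itinerary ::
  "(nat \<Rightarrow> 'a \<Rightarrow> 'a) \<Rightarrow> (nat \<Rightarrow> 'a set set) \<Rightarrow> nat \<Rightarrow> 'a set \<Rightarrow> nat \<Rightarrow> 'a set" where
  "itinerary f P n A = (\<lambda>i\<in>{..<n}. SOME B. B \<in> P i \<and> nds_iterate f 0 i ` A \<subseteq> B)"

lemma itinerary:
  assumes A: "A \<in> nds_join X f P n" and "i < n"
  shows "itinerary f P n A i \<in> P i" "nds_iterate f 0 i ` A \<subseteq> itinerary f P n A i"
proof -
  have "preimage_partition (mspace (X 0)) (nds_iterate f 0 i) (P i) \<in>
      (\<lambda>i. preimage_partition (mspace (X 0)) (nds_iterate f 0 i) (P i)) ` {..<n}"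
    using \<open>i < n\<close> by simp
  then obtain C where "C \<in> preimage_partition (mspace (X 0)) (nds_iterate f 0 i) (P i)" "A \<subseteq> C"
    using common_refinement_exists[OF A[unfolded nds_join_def]] by blast
  then have "\<exists>B. B \<in> P i \<and> nds_iterate f 0 i ` A \<subseteq> B"
    unfolding preimage_partition_def by blast
  then have "itinerary f P n A i \<in> P i \<and> nds_iterate f 0 i ` A \<subseteq> itinerary f P n A i"
    unfolding itinerary_def using \<open>i < n\<close> someI_ex[of "\<lambda>B. B \<in> P i \<and> nds_iterate f 0 i ` A \<subseteq> B"] by simp
  then show "itinerary f P n A i \<in> P i" "nds_iterate f 0 i ` A \<subseteq> itinerary f P n A i"
    by simp_all
qed

text \<open>Blocks with equal itineraries lie in the same preimage at every time below n, hence each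
  contains the other. This turns sums over the join into sums over sequences of blocks.\<close>

lemma inj_on_itinerary:
  assumes nds: "topological_NDS X f" and part: "\<And>n. finite_borel_partition (X n) (P n)" and "0 < n"
  shows "inj_on (itinerary f P n) (nds_join X f P n)"
proof (rule inj_onI)
  note join = finite_borel_partition_nds_join[OF nds part \<open>0 < n\<close>]
  let ?pre = "\<lambda>i. preimage_partition (mspace (X 0)) (nds_iterate f 0 i) (P i)"
  have sub: "A \<subseteq> B"
    if A: "A \<in> nds_join X f P n" and B: "B \<in> nds_join X f P n" and eq: "itinerary f P n A = itinerary f P n B"
    for A B
  proof (rule common_refinement_subset[of "?pre ` {..<n}"])
    show "A \<in> common_refinement (?pre ` {..<n})" "B \<in> common_refinement (?pre ` {..<n})"
      using A B by (simp_all add: nds_join_def)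
    fix Q assume "Q \<in> ?pre ` {..<n}"
    then obtain i where i: "i < n" "Q = ?pre i"
      by blast
    then show "partition_on (mspace (X 0)) Q"
      using finite_borel_partition_preimage[OF measurable_nds_iterate[OF nds] part]
      by (simp add: finite_borel_partition_def)
    let ?C = "nds_iterate f 0 i -` itinerary f P n A i \<inter> mspace (X 0)"
    have "A \<subseteq> ?C" "B \<subseteq> ?C"
      using itinerary(2)[OF A i(1)] itinerary(2)[OF B i(1)] eq
        finite_borel_partition_subset(1)[OF join A] finite_borel_partition_subset(1)[OF join B]
      by auto
    moreover have "?C \<in> Q"
      using itinerary(1)[OF A i(1)] \<open>A \<subseteq> ?C\<close> finite_borel_partition_subset(3)[OF join A]
      unfolding i(2) preimage_partition_def by blast
    ultimately show "\<exists>C\<in>Q. A \<subseteq> C \<and> B \<subseteq> C"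
      by blast
  qed
  fix A B
  assume "A \<in> nds_join X f P n" "B \<in> nds_join X f P n" "itinerary f P n A = itinerary f P n B"
  then show "A = B"
    using sub[of A B] sub[of B A] by simp
qed

lemma itinerary_PiE:
  assumes "A \<in> nds_join X f P n"
  shows "itinerary f P n A \<in> (\<Pi>\<^sub>E i\<in>{..<n}. P i)"
  using itinerary(1)[OF assms] by (auto simp: itinerary_def)

text \<open>The blocks of the join correspond to some of the sequences in the product of the
  \<open>P i\<close>. Adding the remaining nonnegative terms lets the sum factor over time, so
  weights that are subprobabilities at each time give a subprobability on the join.\<close>

lemma sum_prod_itinerary_le:
  fixes w :: "nat \<Rightarrow> 'a set \<Rightarrow> real"
  assumes nds: "topological_NDS X f" and part: "\<And>n. finite_borel_partition (X n) (P n)" and "0 < n"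
    and w: "\<And>i A. 0 \<le> w i A" "\<And>i. i < n \<Longrightarrow> (\<Sum>A\<in>P i. w i A) \<le> 1"
  shows "(\<Sum>A\<in>nds_join X f P n. \<Prod>i<n. w i (itinerary f P n A i)) \<le> 1"
proof -
  have fin: "finite (P i)" for i
    using part[of i] by (simp add: finite_borel_partition_def)
  have "(\<Sum>A\<in>nds_join X f P n. \<Prod>i<n. w i (itinerary f P n A i)) =
      (\<Sum>h\<in>itinerary f P n ` nds_join X f P n. \<Prod>i<n. w i (h i))"
    by (simp add: sum.reindex[OF inj_on_itinerary[OF nds part \<open>0 < n\<close>]])
  also have "\<dots> \<le> (\<Sum>h\<in>(\<Pi>\<^sub>E i\<in>{..<n}. P i). \<Prod>i<n. w i (h i))"
  proof (rule sum_mono2)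
    show "itinerary f P n ` nds_join X f P n \<subseteq> (\<Pi>\<^sub>E i\<in>{..<n}. P i)"
      by (intro image_subsetI itinerary_PiE)
  qed (use fin w(1) in \<open>auto intro: finite_PiE prod_nonneg\<close>)
  also have "\<dots> = (\<Prod>i<n. \<Sum>A\<in>P i. w i A)"
    using fin by (intro prod_sum_PiE[symmetric]) auto
  also have "\<dots> \<le> 1"
    using w by (intro prod_le_1) (auto intro: sum_nonneg)
  finally show ?thesis .
qed

section \<open>The entropy estimate for product systems\<close>

lemma nds_iterate_map_prod:
  "nds_iterate (\<lambda>n. map_prod (f n) (g n)) k n = map_prod (nds_iterate f k n) (nds_iterate g k n)"
  by (induction n) (auto simp: fun_eq_iff map_prod_def)

text \<open>Outside the exceptional set \<open>E i\<close>, the map \<open>D i\<close> predicts the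
  block of \<open>R i\<close> from those of \<open>P i\<close> and \<open>Q i\<close>. In the error
  term, \<open>- ln (1 - \<theta>)\<close> is paid at every step and
  \<open>ln (N / \<theta>)\<close> only on an event of measure at most \<eta>; both parameters are
  left free to be tuned later.\<close>

lemma partition_entropy_nds_join_max_metric_le:
  fixes D :: "nat \<Rightarrow> 'a set \<Rightarrow> 'b set \<Rightarrow> ('a \<times> 'b) set"
  assumes X: "topological_NDS X f" and Y: "topological_NDS Y g" and \<mu>: "IMS X f \<mu>" and \<nu>: "IMS Y g \<nu>"
    and R: "\<And>n. finite_borel_partition (max_metric (X n) (Y n)) (R n)"
    and P: "\<And>n. finite_borel_partition (X n) (P n)" and Q: "\<And>n. finite_borel_partition (Y n) (Q n)"
    and n: "0 < n" and N: "\<And>i. card (R i) \<le> N" and \<theta>: "0 < \<theta>" "\<theta> < 1"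
    and E: "\<And>i. E i \<in> sets (\<mu> i \<Otimes>\<^sub>M \<nu> i)" "\<And>i. measure (\<mu> i \<Otimes>\<^sub>M \<nu> i) (E i) \<le> \<eta>"
    and D: "\<And>i A B C z. A \<in> R i \<Longrightarrow> B \<in> P i \<Longrightarrow> C \<in> Q i \<Longrightarrow> z \<in> A \<Longrightarrow> z \<in> B \<times> C \<Longrightarrow> z \<notin> E i \<Longrightarrow> A = D i B C"
  shows "partition_entropy (\<mu> 0 \<Otimes>\<^sub>M \<nu> 0) (nds_join (\<lambda>n. max_metric (X n) (Y n)) (\<lambda>n. map_prod (f n) (g n)) R n)
    \<le> partition_entropy (\<mu> 0) (nds_join X f P n) + partition_entropy (\<nu> 0) (nds_join Y g Q n) +
      real n * (- ln (1 - \<theta>) + ln (N / \<theta>) * \<eta>)"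
proof -
  let ?Z = "\<lambda>n. max_metric (X n) (Y n)" and ?h = "\<lambda>n. map_prod (f n) (g n)"
  define M where "M = \<mu> 0 \<Otimes>\<^sub>M \<nu> 0"
  define RR where "RR = nds_join ?Z ?h R n"
  define PP where "PP = nds_join X f P n"
  define QQ where "QQ = nds_join Y g Q n"
  define S where "S j = fst j \<times> snd j" for j :: "'a set \<times> 'b set"
  \<comment> \<open>\<open>D i B C\<close> is the block predicted from \<open>B\<close> and \<open>C\<close>; spreading mass \<open>\<theta>\<close> evenly keeps the logarithm
      finite when the prediction fails.\<close>
  define w where "w i A B C = (if A = D i B C then 1 - \<theta> else 0) + \<theta> / N" for i A B C
  define \<alpha> where "\<alpha> = itinerary ?h R n"
  define \<beta> where "\<beta> = itinerary f P n"
  define \<gamma> where "\<gamma> = itinerary g Q n"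
  define v where "v i a j = w i (\<alpha> a i) (\<beta> (fst j) i) (\<gamma> (snd j) i)" for i a j
  \<comment> \<open>For fixed \<open>j\<close> the conditional weights sum over \<open>a\<close> to
    at most 1, and the measures of the rectangles sum to 1, so \<open>q\<close> has total mass at
    most 1. Its logarithm splits into one term for each factor system and one for each time.\<close>
  define q where "q a j = measure (\<mu> 0) (fst j) * measure (\<nu> 0) (snd j) * (\<Prod>i<n. v i a j)" for a j

  note Z = topological_NDS_max_metric[OF X Y] and \<mu>\<nu> = IMS_max_metric[OF X Y \<mu> \<nu>]
  interpret \<mu>: prob_space "\<mu> 0" by (rule IMS_prob_space[OF \<mu>])
  interpret \<nu>: prob_space "\<nu> 0" by (rule IMS_prob_space[OF \<nu>])
  interpret M: prob_space M unfolding M_def by (rule IMS_prob_space[OF \<mu>\<nu>])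
  have space_M: "space M = mspace (X 0) \<times> mspace (Y 0)" and sets_M: "sets M = sets (metric_borel (?Z 0))"
    unfolding M_def by (simp_all add: IMS_space[OF \<mu>\<nu>] IMS_sets[OF \<mu>\<nu>])
  have RR: "finite_borel_partition (?Z 0) RR"
    unfolding RR_def by (rule finite_borel_partition_nds_join[OF Z R n])
  have PP: "finite_borel_partition (X 0) PP"
    unfolding PP_def by (rule finite_borel_partition_nds_join[OF X P n])
  have QQ: "finite_borel_partition (Y 0) QQ"
    unfolding QQ_def by (rule finite_borel_partition_nds_join[OF Y Q n])

  have RR_fam: "finite RR" "disjoint RR" "RR \<subseteq> M.events" "space M \<subseteq> \<Union>RR"
    using RR partition_onD1[of "mspace (?Z 0)" RR] partition_onD2[of "mspace (?Z 0)" RR]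
    by (simp_all add: finite_borel_partition_def sets_M space_M)
  have PP_fam: "finite PP" "disjoint_family_on (\<lambda>b. b) PP" "(\<lambda>b. b) ` PP \<subseteq> \<mu>.events" "space (\<mu> 0) \<subseteq> (\<Union>b\<in>PP. b)"
    using PP partition_onD1[of "mspace (X 0)" PP] partition_onD2[of "mspace (X 0)" PP]
    by (simp_all add: finite_borel_partition_def IMS_sets[OF \<mu>] IMS_space[OF \<mu>] disjoint_family_on_def disjoint_def)
  have QQ_fam: "finite QQ" "disjoint_family_on (\<lambda>b. b) QQ" "(\<lambda>b. b) ` QQ \<subseteq> \<nu>.events" "space (\<nu> 0) \<subseteq> (\<Union>b\<in>QQ. b)"
    using QQ partition_onD1[of "mspace (Y 0)" QQ] partition_onD2[of "mspace (Y 0)" QQ]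
    by (simp_all add: finite_borel_partition_def IMS_sets[OF \<nu>] IMS_space[OF \<nu>] disjoint_family_on_def disjoint_def)
  have S_fam: "finite (PP \<times> QQ)" "disjoint_family_on S (PP \<times> QQ)" "S ` (PP \<times> QQ) \<subseteq> M.events"
      "space M \<subseteq> (\<Union>j\<in>PP \<times> QQ. S j)"
  proof -
    show "disjoint_family_on S (PP \<times> QQ)"
      unfolding disjoint_family_on_def
    proof (intro ballI impI)
      fix j k assume jk: "j \<in> PP \<times> QQ" "k \<in> PP \<times> QQ" "j \<noteq> k"
      then have "fst j \<noteq> fst k \<or> snd j \<noteq> snd k"
        by (simp add: prod_eq_iff)
      then have "fst j \<inter> fst k = {} \<or> snd j \<inter> snd k = {}"
        using jk(1,2) disjoint_family_onD[OF PP_fam(2), of "fst j" "fst k"]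
          disjoint_family_onD[OF QQ_fam(2), of "snd j" "snd k"] by (auto simp: mem_Times_iff)
      then show "S j \<inter> S k = {}"
        by (auto simp: S_def)
    qed
    show "S ` (PP \<times> QQ) \<subseteq> M.events"
      using PP_fam(3) QQ_fam(3) by (auto simp: S_def M_def intro!: pair_measureI)
    show "space M \<subseteq> (\<Union>j\<in>PP \<times> QQ. S j)"
    proof
      fix z assume "z \<in> space M"
      then obtain b c where "b \<in> PP" "fst z \<in> b" "c \<in> QQ" "snd z \<in> c"
        using PP_fam(4) QQ_fam(4) unfolding space_M IMS_space[OF \<mu>] IMS_space[OF \<nu>] mem_Times_iff by blast
      then show "z \<in> (\<Union>j\<in>PP \<times> QQ. S j)"
        by (intro UN_I[of "(b, c)"]) (simp_all add: S_def mem_Times_iff)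
    qed
  qed (use PP_fam(1) QQ_fam(1) in simp)
  have measure_S: "M.prob (S j) = measure (\<mu> 0) (fst j) * measure (\<nu> 0) (snd j)" if "j \<in> PP \<times> QQ" for j
    using that PP_fam(3) QQ_fam(3) unfolding M_def S_def
    by (auto intro!: measure_pair_measure_Times[OF \<nu>.sigma_finite_measure_axioms])
  have sum_PP: "(\<Sum>b\<in>PP. measure (\<mu> 0) b) = 1"
    using \<mu>.sum_measure_Int_family[OF PP_fam sets.top] PP_fam(3) sets.sets_into_space
    by (simp add: \<mu>.prob_space Int_absorb2 subset_iff)
  have sum_QQ: "(\<Sum>c\<in>QQ. measure (\<nu> 0) c) = 1"
    using \<nu>.sum_measure_Int_family[OF QQ_fam sets.top] QQ_fam(3) sets.sets_into_space
    by (simp add: \<nu>.prob_space Int_absorb2 subset_iff)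
  have sum_S: "(\<Sum>j\<in>PP \<times> QQ. \<phi> (fst j) * \<psi> (snd j)) = (\<Sum>b\<in>PP. \<phi> b) * (\<Sum>c\<in>QQ. \<psi> c)" for \<phi> \<psi> :: "_ \<Rightarrow> real"
    by (simp add: sum_product sum.cartesian_product split_beta)
  have total_S: "(\<Sum>j\<in>PP \<times> QQ. M.prob (S j)) = 1"
    using sum_S[of "measure (\<mu> 0)" "measure (\<nu> 0)"] by (simp add: measure_S sum_PP sum_QQ)
  \<comment> \<open>Functions of the rectangle alone can be averaged against the product measure;
    this is how the entropies of the two factors reappear.\<close>
  have marginal: "(\<Sum>a\<in>RR. \<Sum>j\<in>PP \<times> QQ. M.prob (a \<inter> S j) * \<phi> j) = (\<Sum>j\<in>PP \<times> QQ. M.prob (S j) * \<phi> j)"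
    for \<phi> :: "_ \<Rightarrow> real"
  proof -
    have "(\<Sum>a\<in>RR. M.prob (a \<inter> S j)) = M.prob (S j)" if "j \<in> PP \<times> QQ" for j
      using that S_fam(3) RR_fam
      by (intro M.sum_measure_Int_family) (auto simp: disjoint_family_on_def disjoint_def)
    then show ?thesis
      by (subst sum.swap) (simp add: sum_distrib_right[symmetric])
  qed

  have N_pos: "0 < N"
  proof -
    have "mspace (?Z 0) \<noteq> {}"
      using Z by (simp add: topological_NDS_def)
    then have "R 0 \<noteq> {}"
      using finite_borel_partition_covers[OF R] by blast
    then have "0 < card (R 0)"
      using R[of 0] by (simp add: finite_borel_partition_def card_gt_0_iff)
    then show ?thesis
      using N[of 0] by linarith
  qed
  then have \<theta>N: "0 < \<theta> / N" "0 \<le> ln (N / \<theta>)" "0 \<le> - ln (1 - \<theta>)"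
    using \<theta> by (auto simp: field_simps)
  have w_pos: "0 < w i A B C" for i A B C
    using \<theta> \<theta>N(1) by (simp add: w_def add_pos_pos)
  have w_sum: "(\<Sum>A\<in>R i. w i A B C) \<le> 1" for i B C
  proof -
    have fin: "finite (R i)"
      using R[of i] by (simp add: finite_borel_partition_def)
    have "(\<Sum>A\<in>R i. w i A B C) = (\<Sum>A\<in>R i. if A = D i B C then 1 - \<theta> else 0) + card (R i) * (\<theta> / N)"
      unfolding w_def sum.distrib by simp
    also have "(\<Sum>A\<in>R i. if A = D i B C then 1 - \<theta> else 0) \<le> 1 - \<theta>"
      using fin \<theta> by (simp add: sum.delta)
    also have "card (R i) * (\<theta> / N) \<le> N * (\<theta> / N)"
      using N[of i] \<theta>N(1) by (intro mult_right_mono) auto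
    also have "\<dots> = \<theta>"
      using N_pos by simp
    finally show ?thesis
      by simp
  qed
  have v_pos: "0 < v i a j" for i a j
    by (simp add: v_def w_pos)
  have ln_v: "- ln (v i a j) \<le> - ln (1 - \<theta>) + (if \<alpha> a i = D i (\<beta> (fst j) i) (\<gamma> (snd j) i) then 0 else ln (N / \<theta>))"
    for i a j
  proof (cases "\<alpha> a i = D i (\<beta> (fst j) i) (\<gamma> (snd j) i)")
    case True
    have "ln (1 - \<theta>) \<le> ln (1 - \<theta> + \<theta> / N)"
      using \<theta> \<theta>N(1) by simp
    then show ?thesis
      using True by (simp add: v_def w_def)
  next
    case False
    have "- ln (\<theta> / N) = ln (N / \<theta>)"
      using \<theta> N_pos by (simp add: ln_div)
    then show ?thesis
      using False \<theta>N(3) by (simp add: v_def w_def)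
  qed

  define G where "G i = nds_iterate ?h 0 i -` E i \<inter> space M" for i
  have it_meas: "nds_iterate ?h 0 i \<in> measurable M (metric_borel (?Z i))" for i
    unfolding M_def by (rule IMS_measurable[OF \<mu>\<nu> measurable_nds_iterate[OF Z]])
  have E_sets: "E i \<in> sets (metric_borel (?Z i))" for i
    using E(1) by (simp add: IMS_sets[OF \<mu>\<nu>])
  have G_sets: "G i \<in> M.events" for i
    unfolding G_def by (rule measurable_sets[OF it_meas E_sets])
  have G_measure: "M.prob (G i) \<le> \<eta>" for i
  proof -
    have "M.prob (G i) = measure (distr M (metric_borel (?Z i)) (nds_iterate ?h 0 i)) (E i)"
      unfolding G_def by (rule measure_distr[OF it_meas E_sets, symmetric])
    also have "\<dots> = measure (\<mu> i \<Otimes>\<^sub>M \<nu> i) (E i)"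
      unfolding M_def by (simp add: IMS_distr_nds_iterate[OF Z \<mu>\<nu>])
    finally show ?thesis
      using E(2) by simp
  qed
  \<comment> \<open>If the prediction is wrong for \<open>a\<close> and \<open>j\<close>, every
    common point must be exceptional at time i, for otherwise \<open>D\<close> would have named the
    block of \<open>a\<close>.\<close>
  have bad: "a \<inter> S j \<subseteq> G i"
    if i: "i < n" and a: "a \<in> RR" and j: "j \<in> PP \<times> QQ"
      and ne: "\<alpha> a i \<noteq> D i (\<beta> (fst j) i) (\<gamma> (snd j) i)" for i a j
  proof
    fix z assume z: "z \<in> a \<inter> S j"
    obtain b c where bc: "j = (b, c)" "b \<in> PP" "c \<in> QQ"
      using j by blast
    obtain x y where xy: "z = (x, y)" "x \<in> b" "y \<in> c"
      using z by (auto simp: S_def bc(1))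
    have hz: "nds_iterate ?h 0 i z = (nds_iterate f 0 i x, nds_iterate g 0 i y)"
      by (simp add: nds_iterate_map_prod xy(1))
    have "nds_iterate ?h 0 i z \<in> \<alpha> a i"
      using itinerary(2)[OF a[unfolded RR_def] i] z unfolding \<alpha>_def by blast
    moreover have "nds_iterate ?h 0 i z \<in> \<beta> b i \<times> \<gamma> c i"
      using itinerary(2)[OF bc(2)[unfolded PP_def] i] itinerary(2)[OF bc(3)[unfolded QQ_def] i] xy(2,3)
      unfolding hz \<beta>_def \<gamma>_def by blast
    moreover have "\<alpha> a i \<in> R i" "\<beta> b i \<in> P i" "\<gamma> c i \<in> Q i"
      unfolding \<alpha>_def \<beta>_def \<gamma>_def
      using itinerary(1)[OF a[unfolded RR_def] i] itinerary(1)[OF bc(2)[unfolded PP_def] i]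
        itinerary(1)[OF bc(3)[unfolded QQ_def] i] by blast+
    ultimately have "nds_iterate ?h 0 i z \<in> E i"
      using D[of "\<alpha> a i" i "\<beta> b i" "\<gamma> c i" "nds_iterate ?h 0 i z"] ne
      unfolding bc(1) fst_conv snd_conv by argo
    moreover have "z \<in> space M"
      using z a RR_fam(3) sets.sets_into_space[of a M] by blast
    ultimately show "z \<in> G i"
      by (simp add: G_def)
  qed
  have cond: "(\<Sum>a\<in>RR. \<Sum>j\<in>PP \<times> QQ. M.prob (a \<inter> S j) * - ln (v i a j)) \<le> - ln (1 - \<theta>) + ln (N / \<theta>) * \<eta>"
    if i: "i < n" for i
  proof -
    \<comment> \<open>The penalty is charged on \<open>G i\<close> for all pairs. For wrong
      predictions this is all of \<open>a \<inter> S j\<close>, for correct ones it only adds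
      nonnegative terms, and now the penalties sum to the probability of \<open>G i\<close>.\<close>
    have "(\<Sum>a\<in>RR. \<Sum>j\<in>PP \<times> QQ. M.prob (a \<inter> S j) * - ln (v i a j)) \<le>
        (\<Sum>a\<in>RR. \<Sum>j\<in>PP \<times> QQ. M.prob (a \<inter> S j) * - ln (1 - \<theta>) + ln (N / \<theta>) * M.prob (S j \<inter> (a \<inter> G i)))"
    proof (intro sum_mono)
      fix a j assume a: "a \<in> RR" and j: "j \<in> PP \<times> QQ"
      show "M.prob (a \<inter> S j) * - ln (v i a j) \<le>
          M.prob (a \<inter> S j) * - ln (1 - \<theta>) + ln (N / \<theta>) * M.prob (S j \<inter> (a \<inter> G i))"
      proof (cases "\<alpha> a i = D i (\<beta> (fst j) i) (\<gamma> (snd j) i)")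
        case True
        then have "M.prob (a \<inter> S j) * - ln (v i a j) \<le> M.prob (a \<inter> S j) * - ln (1 - \<theta>)"
          using ln_v[of i a j] by (intro mult_left_mono) simp_all
        moreover have "0 \<le> ln (N / \<theta>) * M.prob (S j \<inter> (a \<inter> G i))"
          using \<theta>N(2) by simp
        ultimately show ?thesis
          by linarith
      next
        case False
        have "S j \<inter> (a \<inter> G i) = a \<inter> S j"
          using bad[OF i a j False] by blast
        moreover have "M.prob (a \<inter> S j) * - ln (v i a j) \<le> M.prob (a \<inter> S j) * (- ln (1 - \<theta>) + ln (N / \<theta>))"
          using ln_v[of i a j] False by (intro mult_left_mono) simp_all
        ultimately show ?thesis
          by (simp add: algebra_simps)
      qed
    qed
    also have "\<dots> = (\<Sum>j\<in>PP \<times> QQ. M.prob (S j) * - ln (1 - \<theta>)) + ln (N / \<theta>) * (\<Sum>a\<in>RR. \<Sum>j\<in>PP \<times> QQ. M.prob (S j \<inter> (a \<inter> G i)))"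
      by (simp only: sum.distrib marginal sum_distrib_left)
    also have "(\<Sum>j\<in>PP \<times> QQ. M.prob (S j) * - ln (1 - \<theta>)) = - ln (1 - \<theta>)"
      unfolding sum_distrib_right[symmetric] total_S by simp
    also have "(\<Sum>a\<in>RR. \<Sum>j\<in>PP \<times> QQ. M.prob (S j \<inter> (a \<inter> G i))) = (\<Sum>a\<in>RR. M.prob (a \<inter> G i))"
      using RR_fam(3) G_sets by (intro sum.cong refl M.sum_measure_Int_family S_fam) auto
    also have "\<dots> = M.prob (G i)"
      using RR_fam G_sets by (intro M.sum_measure_Int_family) (auto simp: disjoint_family_on_def disjoint_def)
    finally show ?thesis
      using mult_left_mono[OF G_measure[of i] \<theta>N(2)] by linarith
  qed

  have "partition_entropy M RR \<le> (\<Sum>a\<in>RR. \<Sum>j\<in>PP \<times> QQ. M.prob (a \<inter> S j) * - ln (q a j))"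
  proof (rule M.partition_entropy_le_cross_entropy[OF RR_fam S_fam])
    fix a j assume a: "a \<in> RR" and j: "j \<in> PP \<times> QQ"
    show "0 \<le> q a j"
      unfolding q_def by (intro mult_nonneg_nonneg prod_nonneg less_imp_le[OF v_pos] measure_nonneg)
    assume "0 < M.prob (a \<inter> S j)"
    also have "\<dots> \<le> M.prob (S j)"
      using S_fam(3) j by (intro M.finite_measure_mono) auto
    finally have "0 < measure (\<mu> 0) (fst j) * measure (\<nu> 0) (snd j)"
      by (simp add: measure_S[OF j])
    then show "0 < q a j"
      unfolding q_def by (rule mult_pos_pos) (intro prod_pos v_pos)
  next
    have "(\<Sum>a\<in>RR. \<Sum>j\<in>PP \<times> QQ. q a j) = (\<Sum>j\<in>PP \<times> QQ. measure (\<mu> 0) (fst j) * measure (\<nu> 0) (snd j) * (\<Sum>a\<in>RR. \<Prod>i<n. v i a j))"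
      by (subst sum.swap) (simp add: q_def sum_distrib_left)
    also have "\<dots> \<le> (\<Sum>j\<in>PP \<times> QQ. measure (\<mu> 0) (fst j) * measure (\<nu> 0) (snd j) * 1)"
    proof (intro sum_mono mult_left_mono)
      fix j
      show "(\<Sum>a\<in>RR. \<Prod>i<n. v i a j) \<le> 1"
        unfolding RR_def v_def \<alpha>_def
        by (rule sum_prod_itinerary_le[OF Z R n]) (use w_sum w_pos in \<open>auto intro: less_imp_le\<close>)
    qed simp
    also have "\<dots> = 1"
      using sum_S[of "measure (\<mu> 0)" "measure (\<nu> 0)"] sum_PP sum_QQ by simp
    finally show "(\<Sum>a\<in>RR. \<Sum>j\<in>PP \<times> QQ. q a j) \<le> 1" .
  qed
  also have "\<dots> = (\<Sum>a\<in>RR. \<Sum>j\<in>PP \<times> QQ. M.prob (a \<inter> S j) * - ln (measure (\<mu> 0) (fst j)) +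
      M.prob (a \<inter> S j) * - ln (measure (\<nu> 0) (snd j)) + (\<Sum>i<n. M.prob (a \<inter> S j) * - ln (v i a j)))"
  proof (intro sum.cong refl)
    fix a j assume a: "a \<in> RR" and j: "j \<in> PP \<times> QQ"
    show "M.prob (a \<inter> S j) * - ln (q a j) = M.prob (a \<inter> S j) * - ln (measure (\<mu> 0) (fst j)) +
      M.prob (a \<inter> S j) * - ln (measure (\<nu> 0) (snd j)) + (\<Sum>i<n. M.prob (a \<inter> S j) * - ln (v i a j))"
    \<comment> \<open>At probability 0 both sides vanish whatever the logarithms are. Otherwise both
      measures in \<open>q\<close> are positive and the logarithm of the product splits.\<close>
    proof (cases "M.prob (a \<inter> S j) = 0")
      case False
      have "M.prob (a \<inter> S j) \<le> M.prob (S j)"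
        using S_fam(3) j by (intro M.finite_measure_mono) auto
      then have "measure (\<mu> 0) (fst j) * measure (\<nu> 0) (snd j) \<noteq> 0"
        using False measure_nonneg[of M "a \<inter> S j"] measure_S[OF j] by linarith
      then have pos: "0 < measure (\<mu> 0) (fst j)" "0 < measure (\<nu> 0) (snd j)"
        by (simp_all add: zero_less_measure_iff)
      have "ln (q a j) = ln (measure (\<mu> 0) (fst j)) + ln (measure (\<nu> 0) (snd j)) + (\<Sum>i<n. ln (v i a j))"
        unfolding q_def using pos ln_prod[of "{..<n}" "\<lambda>i. v i a j", OF _ less_imp_neq[OF v_pos, symmetric]]
        by (simp add: ln_mult_pos prod_pos v_pos)
      then show ?thesis
        by (simp add: sum_distrib_left sum_negf algebra_simps)
    qed simp
  qed
  also have "\<dots> = (\<Sum>j\<in>PP \<times> QQ. M.prob (S j) * - ln (measure (\<mu> 0) (fst j))) +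
      (\<Sum>j\<in>PP \<times> QQ. M.prob (S j) * - ln (measure (\<nu> 0) (snd j))) +
      (\<Sum>a\<in>RR. \<Sum>j\<in>PP \<times> QQ. \<Sum>i<n. M.prob (a \<inter> S j) * - ln (v i a j))"
    by (simp only: sum.distrib marginal)
  also have "(\<Sum>j\<in>PP \<times> QQ. M.prob (S j) * - ln (measure (\<mu> 0) (fst j))) = partition_entropy (\<mu> 0) PP"
    using sum_S[of "\<lambda>b. measure (\<mu> 0) b * - ln (measure (\<mu> 0) b)" "measure (\<nu> 0)"]
    by (simp add: measure_S sum_QQ partition_entropy_def sum_negf mult_ac)
  also have "(\<Sum>j\<in>PP \<times> QQ. M.prob (S j) * - ln (measure (\<nu> 0) (snd j))) = partition_entropy (\<nu> 0) QQ"
    using sum_S[of "measure (\<mu> 0)" "\<lambda>c. measure (\<nu> 0) c * - ln (measure (\<nu> 0) c)"]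
    by (simp add: measure_S sum_PP partition_entropy_def sum_negf mult_ac)
  also have "(\<Sum>a\<in>RR. \<Sum>j\<in>PP \<times> QQ. \<Sum>i<n. M.prob (a \<inter> S j) * - ln (v i a j)) =
      (\<Sum>i<n. \<Sum>a\<in>RR. \<Sum>j\<in>PP \<times> QQ. M.prob (a \<inter> S j) * - ln (v i a j))"
    by (simp only: sum.swap[of _ "{..<n}"])
  also have "\<dots> \<le> (\<Sum>i<n. - ln (1 - \<theta>) + ln (N / \<theta>) * \<eta>)"
    using cond by (intro sum_mono) simp
  finally show ?thesis
    by (simp add: M_def RR_def PP_def QQ_def)
qed

lemma entropy_wrt_max_metric_le:
  assumes X: "topological_NDS X f" and Y: "topological_NDS Y g"
    and \<mu>: "fine_scale_IMS X f \<mu>" and \<nu>: "fine_scale_IMS Y g \<nu>"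
    and R: "R \<in> admissible (\<lambda>n. max_metric (X n) (Y n)) (\<lambda>n. \<mu> n \<Otimes>\<^sub>M \<nu> n)"
  shows "entropy_wrt (\<lambda>n. max_metric (X n) (Y n)) (\<lambda>n. map_prod (f n) (g n)) (\<lambda>n. \<mu> n \<Otimes>\<^sub>M \<nu> n) R
    \<le> metric_entropy X f \<mu> + metric_entropy Y g \<nu>"
proof (rule ereal_le_epsilon2)
  fix e :: real assume "0 < e"
  let ?Z = "\<lambda>n. max_metric (X n) (Y n)" and ?h = "\<lambda>n. map_prod (f n) (g n)" and ?\<mu>\<nu> = "\<lambda>n. \<mu> n \<Otimes>\<^sub>M \<nu> n"
  have IMS: "IMS X f \<mu>" "IMS Y g \<nu>"
    using \<mu> \<nu> by (simp_all add: fine_scale_IMS_def)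
  note IMS_prod = IMS_max_metric[OF X Y IMS] and pR = admissible_partition[OF R]
  have fin: "finite (R n)" for n
    using pR by (simp add: finite_borel_partition_def)
  obtain N where N: "\<And>n. card (R n) \<le> N"
    using admissible_card_bounded[OF R] by blast
  \<comment> \<open>Chosen so that the unconditional cost per step is exactly
    \<open>e / 2\<close>.\<close>
  define \<theta> where "\<theta> = 1 - exp (- (e / 2))"
  \<comment> \<open>The exceptional set collects at most \<open>N\<close> remainders of measure
    \<eta> each, so the expected penalty is at most \<open>ln (N / \<theta>) * (N * \<eta>)\<close>,
    to be kept below \<open>e / 2\<close>. The added ones and the absolute value keep the
    denominator positive.\<close>
  define \<eta> where "\<eta> = e / (2 * (real N + 1) * (1 + \<bar>ln (N / \<theta>)\<bar>))"
  have \<theta>: "0 < \<theta>" "\<theta> < 1" "- ln (1 - \<theta>) = e / 2"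
    using \<open>0 < e\<close> by (simp_all add: \<theta>_def)
  have "0 < \<eta>"
    unfolding \<eta>_def using \<open>0 < e\<close> by (intro divide_pos_pos mult_pos_pos) (simp_all add: add_pos_nonneg)
  have \<eta>: "ln (N / \<theta>) * (N * \<eta>) \<le> e / 2"
  proof -
    have "ln (N / \<theta>) * (N * \<eta>) \<le> (1 + \<bar>ln (N / \<theta>)\<bar>) * ((real N + 1) * \<eta>)"
      using \<open>0 < \<eta>\<close> by (intro mult_mono) auto
    also have "\<dots> = e / 2"
      unfolding \<eta>_def by (simp add: divide_simps add_nonneg_eq_0_iff)
    finally show ?thesis .
  qed
  obtain \<delta> K where "\<delta> > 0" and K: "\<And>n A. A \<in> R n \<Longrightarrow> K n A \<subseteq> A"
    "\<And>n A. A \<in> R n \<Longrightarrow> compactin (mtopology_of (?Z n)) (K n A)"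
    "\<And>n A. A \<in> R n \<Longrightarrow> measure (?\<mu>\<nu> n) (A - K n A) \<le> \<eta>"
    "\<And>n A B x y. A \<in> R n \<Longrightarrow> B \<in> R n \<Longrightarrow> A \<noteq> B \<Longrightarrow> x \<in> K n A \<Longrightarrow> y \<in> K n B \<Longrightarrow> \<delta> \<le> mdist (?Z n) x y"
    using admissibleE[OF R \<open>0 < \<eta>\<close>] by blast
  obtain P where P: "P \<in> admissible X \<mu>" "\<And>n A x y. A \<in> P n \<Longrightarrow> x \<in> A \<Longrightarrow> y \<in> A \<Longrightarrow> mdist (X n) x y < \<delta>"
    using \<mu> \<open>\<delta> > 0\<close> unfolding fine_scale_IMS_iff by meson
  obtain Q where Q: "Q \<in> admissible Y \<nu>" "\<And>n A x y. A \<in> Q n \<Longrightarrow> x \<in> A \<Longrightarrow> y \<in> A \<Longrightarrow> mdist (Y n) x y < \<delta>"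
    using \<nu> \<open>\<delta> > 0\<close> unfolding fine_scale_IMS_iff by meson
  define E where "E n = (\<Union>A\<in>R n. A - K n A)" for n
  \<comment> \<open>The sets \<open>K n A\<close> are \<delta>-separated and points of
    \<open>B \<times> C\<close> are closer than \<delta>, so at most one \<open>A\<close> qualifies.
    If none does, the value is arbitrary, but then every point of \<open>B \<times> C\<close> in a
    block of \<open>R n\<close> lies in \<open>E n\<close>.\<close>
  define D where "D n B C = (SOME A. A \<in> R n \<and> K n A \<inter> B \<times> C \<noteq> {})" for n B C
  have diff_sets: "A - K n A \<in> sets (?\<mu>\<nu> n)" if "A \<in> R n" for n A
    using finite_borel_partition_subset(2)[OF pR that] compactin_sets_metric_borel[OF K(2)[OF that]]
    unfolding IMS_sets[OF IMS_prod] by blast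
  have E_sets: "E n \<in> sets (?\<mu>\<nu> n)" for n
    unfolding E_def by (intro sets.finite_UN fin diff_sets)
  have E_measure: "measure (?\<mu>\<nu> n) (E n) \<le> N * \<eta>" for n
  proof -
    interpret prob_space "?\<mu>\<nu> n" by (rule IMS_prob_space[OF IMS_prod])
    have "prob (E n) \<le> (\<Sum>A\<in>R n. prob (A - K n A))"
      unfolding E_def using diff_sets fin by (intro finite_measure_subadditive_finite) auto
    also have "\<dots> \<le> card (R n) * \<eta>"
      using K(3) by (intro sum_bounded_above) simp
    also have "\<dots> \<le> N * \<eta>"
      using N \<open>0 < \<eta>\<close> by (intro mult_right_mono) simp_all
    finally show ?thesis .
  qed
  have D: "A = D n B C"
    if A: "A \<in> R n" and BC: "B \<in> P n" "C \<in> Q n" and z: "z \<in> A" "z \<in> B \<times> C" "z \<notin> E n" for n A B C z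
  proof -
    have zK: "z \<in> K n A"
      using A z unfolding E_def by blast
    have "D n B C = A"
      unfolding D_def
    proof (rule some_equality)
      show "A \<in> R n \<and> K n A \<inter> B \<times> C \<noteq> {}"
        using A zK z by blast
      fix A' assume A': "A' \<in> R n \<and> K n A' \<inter> B \<times> C \<noteq> {}"
      then obtain z' where z': "z' \<in> K n A'" "z' \<in> B \<times> C"
        by blast
      have "mdist (?Z n) z' z < \<delta>"
        using P(2)[OF BC(1)] Q(2)[OF BC(2)] z(2) z'(2) by (auto simp: max_dist_def)
      then show "A' = A"
        using K(4)[of A' n A z' z] A' A z'(1) zK by fastforce
    qed
    then show ?thesis
      by simp
  qed
  let ?H = "\<lambda>n. partition_entropy (?\<mu>\<nu> 0) (nds_join ?Z ?h R n) / real n"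
    and ?H1 = "\<lambda>n. partition_entropy (\<mu> 0) (nds_join X f P n) / real n"
    and ?H2 = "\<lambda>n. partition_entropy (\<nu> 0) (nds_join Y g Q n) / real n"
  have "?H n \<le> ?H1 n + ?H2 n + e" if n: "0 < n" for n
  proof -
    have "partition_entropy (?\<mu>\<nu> 0) (nds_join ?Z ?h R n) \<le>
        partition_entropy (\<mu> 0) (nds_join X f P n) + partition_entropy (\<nu> 0) (nds_join Y g Q n) +
        real n * (- ln (1 - \<theta>) + ln (N / \<theta>) * (N * \<eta>))"
      by (rule partition_entropy_nds_join_max_metric_le[OF X Y IMS pR admissible_partition[OF P(1)]
            admissible_partition[OF Q(1)] n N \<theta>(1,2) E_sets E_measure D])
    also have "real n * (- ln (1 - \<theta>) + ln (N / \<theta>) * (N * \<eta>)) \<le> real n * e"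
      using \<theta>(3) \<eta> by (intro mult_left_mono) auto
    finally show ?thesis
      using n by (simp add: field_simps)
  qed
  then have "eventually (\<lambda>n. ereal (?H n) \<le> ereal (?H1 n) + ereal (?H2 n) + ereal e) sequentially"
    by (auto intro: eventually_mono[OF eventually_gt_at_top[of 0]])
  then have "limsup (\<lambda>n. ereal (?H n)) \<le> limsup (\<lambda>n. ereal (?H1 n) + ereal (?H2 n) + ereal e)"
    by (rule Limsup_mono)
  also have "\<dots> \<le> limsup (\<lambda>n. ereal (?H1 n) + ereal (?H2 n)) + limsup (\<lambda>n. ereal e)"
    by (rule ereal_limsup_add_mono)
  also have "\<dots> \<le> (limsup (\<lambda>n. ereal (?H1 n)) + limsup (\<lambda>n. ereal (?H2 n))) + ereal e"
    by (intro add_mono ereal_limsup_add_mono) (simp add: Limsup_const)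
  \<comment> \<open>\<open>P\<close> and \<open>Q\<close> were chosen depending on \<open>e\<close>;
    passing to the suprema removes them, so that \<open>e\<close> can then be made arbitrarily
    small.\<close>
  also have "\<dots> \<le> (metric_entropy X f \<mu> + metric_entropy Y g \<nu>) + ereal e"
    unfolding metric_entropy_def entropy_wrt_def
    by (intro add_mono order_refl SUP_upper2[OF P(1)] SUP_upper2[OF Q(1)])
  finally show "entropy_wrt ?Z ?h ?\<mu>\<nu> R \<le> metric_entropy X f \<mu> + metric_entropy Y g \<nu> + ereal e"
    by (simp only: entropy_wrt_def)
qed

theorem proposition3p5:
  shows
    "(\<forall>(X :: nat \<Rightarrow> 'a metric) f.
        topological_NDS X f \<longrightarrow>
        ((\<exists>\<mu>. fine_scale_IMS X f \<mu>) \<longleftrightarrow> uniformly_totally_bounded X))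
   \<and> (\<forall>(X :: nat \<Rightarrow> 'a metric) f (Y :: nat \<Rightarrow> 'b metric) g \<pi> \<mu>.
        topological_NDS X f \<longrightarrow> topological_NDS Y g \<longrightarrow>
        equi_conjugate X f Y g \<pi> \<longrightarrow> fine_scale_IMS X f \<mu> \<longrightarrow>
        fine_scale_IMS Y g (\<lambda>n. distr (\<mu> n) (metric_borel (Y n)) (\<pi> n)))
   \<and> (\<forall>(X :: nat \<Rightarrow> 'a metric) f (Y :: nat \<Rightarrow> 'b metric) g \<mu> \<nu>.
        topological_NDS X f \<longrightarrow> topological_NDS Y g \<longrightarrow>
        fine_scale_IMS X f \<mu> \<longrightarrow> fine_scale_IMS Y g \<nu> \<longrightarrow>
        topological_NDS (\<lambda>n. max_metric (X n) (Y n)) (\<lambda>n. map_prod (f n) (g n)) \<and>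
        fine_scale_IMS (\<lambda>n. max_metric (X n) (Y n)) (\<lambda>n. map_prod (f n) (g n))
          (\<lambda>n. \<mu> n \<Otimes>\<^sub>M \<nu> n) \<and>
        metric_entropy (\<lambda>n. max_metric (X n) (Y n)) (\<lambda>n. map_prod (f n) (g n))
            (\<lambda>n. \<mu> n \<Otimes>\<^sub>M \<nu> n)
          \<le> metric_entropy X f \<mu> + metric_entropy Y g \<nu>)"
proof (intro conjI allI impI)
  fix X :: "nat \<Rightarrow> 'a metric" and f
  assume "topological_NDS X f"
  then show "(\<exists>\<mu>. fine_scale_IMS X f \<mu>) \<longleftrightarrow> uniformly_totally_bounded X"
    using fine_scale_IMS_imp_uniformly_totally_bounded uniformly_totally_bounded_imp_fine_scale_IMS by blast
next
  fix X :: "nat \<Rightarrow> 'a metric" and f and Y :: "nat \<Rightarrow> 'b metric" and g \<pi> \<mu>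
  assume "topological_NDS X f" "topological_NDS Y g" "equi_conjugate X f Y g \<pi>" "fine_scale_IMS X f \<mu>"
  then show "fine_scale_IMS Y g (\<lambda>n. distr (\<mu> n) (metric_borel (Y n)) (\<pi> n))"
    by (rule fine_scale_IMS_equi_conjugate)
next
  fix X :: "nat \<Rightarrow> 'a metric" and f and Y :: "nat \<Rightarrow> 'b metric" and g \<mu> \<nu>
  assume A: "topological_NDS X f" "topological_NDS Y g" "fine_scale_IMS X f \<mu>" "fine_scale_IMS Y g \<nu>"
  show "topological_NDS (\<lambda>n. max_metric (X n) (Y n)) (\<lambda>n. map_prod (f n) (g n))"
    by (rule topological_NDS_max_metric[OF A(1,2)])
  show "fine_scale_IMS (\<lambda>n. max_metric (X n) (Y n)) (\<lambda>n. map_prod (f n) (g n)) (\<lambda>n. \<mu> n \<Otimes>\<^sub>M \<nu> n)"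
    by (rule fine_scale_IMS_max_metric[OF A])
  show "metric_entropy (\<lambda>n. max_metric (X n) (Y n)) (\<lambda>n. map_prod (f n) (g n)) (\<lambda>n. \<mu> n \<Otimes>\<^sub>M \<nu> n)
      \<le> metric_entropy X f \<mu> + metric_entropy Y g \<nu>"
    unfolding metric_entropy_def[of "\<lambda>n. max_metric (X n) (Y n)"]
    by (rule SUP_least) (rule entropy_wrt_max_metric_le[OF A])
qed

end
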